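(* Let $p=1/2$. Then $$-\frac{\pi}{\sqrt6}\le\liminf_{t\to\infty}\frac{\log\mathbb{P}(X_t=O)}{\sqrt t}\le\limsup_{t\to\infty}\frac{\log\mathbb{P}(X_t=O)}{\sqrt t}\le-\int_0^\infty\big(-\log\Phi(x)\big)\,dx,$$ where $\Phi$ is the standard normal distribution function. In particular there exist $c,c'>0$ with $-c\le\liminf\le\limsup\le -c'$.
   Context: The simple exclusion process on $\mathbb{Z}$ with parameter $p\in(0,1)$: each site is occupied by at most one particle; each particle attempts to jump one site to the right at rate $p$ and one site to the left at rate $1-p$, an attempt succeeding iff the target site is empty. $O$ is the configuration with every negative site occupied and every non-negative site empty. $\mathbb{P}$ is the law of the process started from $O$, $X_t$ the state at time $t$. *)

theory Defs
  imports "HOL-Probability.Probability"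
begin

text \<open>Configurations of the exclusion process on the integers are represented by the
  set of occupied sites.  O is the step configuration: all negative sites occupied.\<close>

definition O_conf :: "int set" where
  "O_conf = {x. x < 0}"

definition sep_rate :: "real \<Rightarrow> int set \<Rightarrow> int set \<Rightarrow> real" where
  "sep_rate p A B =
     (if \<exists>x. x \<in> A \<and> x + 1 \<notin> A \<and> B = insert (x + 1) (A - {x}) then p else 0)
   + (if \<exists>x. x \<in> A \<and> x - 1 \<notin> A \<and> B = insert (x - 1) (A - {x}) then 1 - p else 0)"

text \<open>Total rate of leaving configuration A (finite for configurations that differ
  from O_conf at finitely many sites).\<close>

definition sep_exit_rate :: "real \<Rightarrow> int set \<Rightarrow> real" where
  "sep_exit_rate p A =
     p * real (card {x. x \<in> A \<and> x + 1 \<notin> A})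
   + (1 - p) * real (card {x. x \<in> A \<and> x - 1 \<notin> A})"

definition sep_gen :: "real \<Rightarrow> int set \<Rightarrow> int set \<Rightarrow> real" where
  "sep_gen p A B = (if A = B then - sep_exit_rate p A else sep_rate p A B)"

definition trunc_states :: "nat \<Rightarrow> int set set" where
  "trunc_states N = {A. (A - O_conf) \<union> (O_conf - A) \<subseteq> {- int N .. int N}}"

fun gen_pow :: "real \<Rightarrow> nat \<Rightarrow> nat \<Rightarrow> int set \<Rightarrow> int set \<Rightarrow> real" where
  "gen_pow p N 0 A B = (if A = B then 1 else 0)"
| "gen_pow p N (Suc k) A B = (\<Sum>C\<in>trunc_states N. sep_gen p A C * gen_pow p N k C B)"

text \<open>Transition function of the process killed upon the discrepancy with O_conf
  leaving the window [-N, N]: the matrix exponential exp(t Q_N).\<close>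

definition killed_trans :: "real \<Rightarrow> nat \<Rightarrow> real \<Rightarrow> int set \<Rightarrow> int set \<Rightarrow> real" where
  "killed_trans p N t A B = (\<Sum>k. t ^ k / fact k * gen_pow p N k A B)"

text \<open>P(X_t = O) for the process started from O: the (monotone) limit of the killed
  transition probabilities as the window grows (minimal/actual process; the process
  started from O makes only finitely many jumps in bounded time).\<close>

definition prob_return :: "real \<Rightarrow> real \<Rightarrow> real" where
  "prob_return p t = lim (\<lambda>N. killed_trans p N t O_conf O_conf)"

definition std_normal_cdf :: "real \<Rightarrow> real" where
  "std_normal_cdf x = (LINT y:{..x}|lborel. std_normal_density y)"

end

theory Submission
  imports Defs
begin

text \<open>The killed transition functions are exponentials of finite matrices with nonnegative
  off-diagonal entries, so they obey a comparison principle for super- and subsolutions of the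
  backward equation.

  Upper bound: if u solves the discrete heat equation started from the indicator of the negative
  sites, the product of u over the occupied sites is a supersolution for the exclusion dynamics
  (Liggett's inequality), whence P(X_t = O) is at most the product over k of P(S_t < k) for a
  simple random walk S.  The factors are compared with the normal distribution function by
  perturbing the Gaussian profile into a supersolution of the discrete heat equation, and the
  logarithm of the product is a Riemann sum.

  Lower bound: by reversibility and the Cauchy-Schwarz inequality, P(X_t = O) is at least
  P(X_{t/2} in S)^2 / |S|.  Take S to be the configurations of energy below M = k^2 t / 4 with k > 1.
  The energy has drift 1/2, so the probability stays away from 0 by Markov's inequality, and |S| is
  bounded by exp(r M) times the partition function, the product over all sites x of
  1 + exp(-r |x + 1/2|); the integral of ln (1 + exp(-x)) over x > 0, which
  is pi^2 / 12, gives the constant.\<close>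

section \<open>Exponentials of finite matrices\<close>

text \<open>\<open>prob_return\<close> is a limit over windows, so both bounds are proved for the
  killed matrix with estimates uniform in \<open>N\<close>, and the killing has to err in the right
  direction each time. For the lower bound this is why the test function is
  \<open>1 - energy / M\<close> and not the energy itself: it is nonpositive wherever the process is
  killed.

  The threshold t / 4 is the drift 1/2 run for time t / 2; any k > 1 leaves a fixed probability
  below M, and k may be taken arbitrarily close to 1. The resulting count exp (2 pi sqrt (M / 6)) =
  exp (pi sqrt (2 M / 3)) is the Hardy-Ramanujan growth of partitions, so admitting unbalanced
  configurations does not spoil the rate.

  For the upper bound the obstacle is that the comparison with the normal distribution function has
  an additive error that does not decay in space, which no infinite product survives. The product is
  therefore cut after about X sqrt t factors; the error is removed for fixed X, and X tends to
  infinity last.\<close>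

fun mpow :: "'a set \<Rightarrow> ('a \<Rightarrow> 'a \<Rightarrow> real) \<Rightarrow> nat \<Rightarrow> 'a \<Rightarrow> 'a \<Rightarrow> real" where
  "mpow S q 0 A B = (if A = B then 1 else 0)"
| "mpow S q (Suc k) A B = (\<Sum>C\<in>S. q A C * mpow S q k C B)"

definition mexp :: "'a set \<Rightarrow> ('a \<Rightarrow> 'a \<Rightarrow> real) \<Rightarrow> real \<Rightarrow> 'a \<Rightarrow> 'a \<Rightarrow> real" where
  "mexp S q t A B = (\<Sum>k. t ^ k / fact k * mpow S q k A B)"

lemma mpow_Suc_right:
  assumes "finite S" "A \<in> S" "B \<in> S"
  shows "mpow S q (Suc k) A B = (\<Sum>C\<in>S. mpow S q k A C * q C B)"
  using assms(2)
proof (induction k arbitrary: A)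
  case 0
  have "(\<Sum>C\<in>S. q A C * (if C = B then 1 else 0)) = q A B"
    using assms by (simp add: if_distrib cong: if_cong)
  moreover have "(\<Sum>C\<in>S. (if A = C then 1 else 0) * q C B) = q A B"
    using assms 0 by (simp add: if_distrib[where f="\<lambda>x. x * _"] cong: if_cong)
  ultimately show ?case by simp
next
  case (Suc k)
  have "mpow S q (Suc (Suc k)) A B = (\<Sum>C\<in>S. q A C * (\<Sum>D\<in>S. mpow S q k C D * q D B))"
    by (subst mpow.simps(2), rule sum.cong) (use Suc.IH in auto)
  also have "\<dots> = (\<Sum>D\<in>S. (\<Sum>C\<in>S. q A C * mpow S q k C D) * q D B)"
    by (simp add: sum_distrib_left sum_distrib_right mult.assoc) (rule sum.swap)
  finally show ?case by simp
qed

lemma mpow_sym: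
  assumes "finite S" "\<And>C D. q C D = q D C" "A \<in> S" "B \<in> S"
  shows "mpow S q k A B = mpow S q k B A"
  using assms(3,4)
proof (induction k arbitrary: A B)
  case (Suc k)
  have "mpow S q (Suc k) A B = (\<Sum>C\<in>S. mpow S q k B C * q C A)"
    by (subst mpow.simps(2), rule sum.cong) (use Suc assms(2)[of A] in \<open>auto simp: mult.commute\<close>)
  also have "\<dots> = mpow S q (Suc k) B A"
    using mpow_Suc_right[OF assms(1), of B A q k] Suc.prems by simp
  finally show ?case .
qed auto

lemma mpow_nonneg:
  assumes "\<And>C D. C \<in> S \<Longrightarrow> D \<in> S \<Longrightarrow> 0 \<le> q C D" "A \<in> S"
  shows "0 \<le> mpow S q k A B"
  using assms(2)
proof (induction k arbitrary: A)
  case (Suc k)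
  then show ?case by (auto intro!: sum_nonneg mult_nonneg_nonneg assms(1))
qed auto

lemma mpow_bound:
  assumes "finite S" "A \<in> S"
  shows "\<bar>mpow S q k A B\<bar> \<le> (\<Sum>C\<in>S. \<Sum>D\<in>S. \<bar>q C D\<bar>) ^ k"
  using assms(2)
proof (induction k arbitrary: A)
  case (Suc k)
  let ?c = "\<Sum>C\<in>S. \<Sum>D\<in>S. \<bar>q C D\<bar>"
  have c: "?c \<ge> 0" by (intro sum_nonneg) auto
  have "\<bar>mpow S q (Suc k) A B\<bar> \<le> (\<Sum>C\<in>S. \<bar>q A C\<bar> * \<bar>mpow S q k C B\<bar>)"
    unfolding mpow.simps by (rule order_trans[OF sum_abs]) (simp add: abs_mult)
  also have "\<dots> \<le> (\<Sum>C\<in>S. \<bar>q A C\<bar> * ?c ^ k)"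
    by (intro sum_mono mult_left_mono Suc.IH) auto
  also have "\<dots> = (\<Sum>C\<in>S. \<bar>q A C\<bar>) * ?c ^ k" by (simp add: sum_distrib_right)
  also have "\<dots> \<le> ?c * ?c ^ k"
    using assms(1) Suc.prems c
    by (intro mult_right_mono member_le_sum[where f="\<lambda>C. \<Sum>D\<in>S. \<bar>q C D\<bar>"] sum_nonneg) auto
  finally show ?case by simp
qed auto

lemma summable_exp_bounded:
  fixes a :: "nat \<Rightarrow> real"
  assumes "\<And>k. \<bar>a k\<bar> \<le> c ^ k"
  shows "summable (\<lambda>k. t ^ k / fact k * a k)"
proof (rule summable_comparison_test)
  show "\<exists>N. \<forall>n\<ge>N. norm (t ^ n / fact n * a n) \<le> inverse (fact n) * (\<bar>t\<bar> * c) ^ n"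
    using assms by (auto simp: abs_mult power_abs power_mult_distrib divide_simps intro!: mult_left_mono)
  show "summable (\<lambda>n. inverse (fact n) * (\<bar>t\<bar> * c) ^ n)" by (rule summable_exp)
qed

lemma summable_mexp:
  assumes "finite S" "A \<in> S"
  shows "summable (\<lambda>k. t ^ k / fact k * mpow S q k A B)"
  by (rule summable_exp_bounded[OF mpow_bound[OF assms]])

text \<open>Stated for a bare coefficient sequence because it serves twice: for the matrix
  exponential and for the Poisson mixture \<open>walk_neg_prob\<close>.\<close>

lemma exp_series_deriv:
  fixes a :: "nat \<Rightarrow> real"
  assumes "\<And>k. \<bar>a k\<bar> \<le> c ^ k"
  shows "((\<lambda>t. \<Sum>k. t ^ k / fact k * a k) has_real_derivative (\<Sum>k. t ^ k / fact k * a (Suc k))) (at t)"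
proof -
  let ?a = "\<lambda>k. a k / fact k"
  have "((\<lambda>t. \<Sum>k. ?a k * t ^ k) has_real_derivative (\<Sum>k. diffs ?a k * t ^ k)) (at t)"
    by (rule termdiffs_strong_converges_everywhere)
       (use summable_exp_bounded[OF assms] in \<open>simp add: mult.commute\<close>)
  moreover have "diffs ?a k * t ^ k = t ^ k / fact k * a (Suc k)" for k
    by (simp add: diffs_def field_simps del: of_nat_Suc)
  ultimately show ?thesis by (simp add: mult.commute)
qed

lemma mexp_deriv_series:
  assumes "finite S" "A \<in> S"
  shows "((\<lambda>t. mexp S q t A B) has_real_derivative (\<Sum>k. t ^ k / fact k * mpow S q (Suc k) A B)) (at t)"
  unfolding mexp_def by (rule exp_series_deriv[OF mpow_bound[OF assms]])

lemma mexp_backward: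
  assumes "finite S" "A \<in> S"
  shows "((\<lambda>t. mexp S q t A B) has_real_derivative (\<Sum>C\<in>S. q A C * mexp S q t C B)) (at t)"
proof -
  have "(\<Sum>k. t ^ k / fact k * mpow S q (Suc k) A B)
      = (\<Sum>k. \<Sum>C\<in>S. q A C * (t ^ k / fact k * mpow S q k C B))"
    by (simp add: sum_distrib_left mult_ac)
  also have "\<dots> = (\<Sum>C\<in>S. q A C * mexp S q t C B)"
    unfolding mexp_def
    by (subst suminf_sum, rule summable_mult, erule summable_mexp[OF assms(1)], rule sum.cong[OF refl], rule suminf_mult, erule summable_mexp[OF assms(1)])
  finally show ?thesis using mexp_deriv_series[OF assms, of q B t] by simp
qed

lemma mexp_forward:
  assumes "finite S" "A \<in> S" "B \<in> S"
  shows "((\<lambda>t. mexp S q t A B) has_real_derivative (\<Sum>C\<in>S. mexp S q t A C * q C B)) (at t)"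
proof -
  have "(\<Sum>k. t ^ k / fact k * mpow S q (Suc k) A B)
      = (\<Sum>k. \<Sum>C\<in>S. q C B * (t ^ k / fact k * mpow S q k A C))"
    using assms by (simp add: mpow_Suc_right sum_distrib_left mult_ac del: mpow.simps)
  also have "\<dots> = (\<Sum>C\<in>S. q C B * mexp S q t A C)"
    unfolding mexp_def
    by (subst suminf_sum, rule summable_mult, rule summable_mexp[OF assms(1,2)], rule sum.cong[OF refl], rule suminf_mult, rule summable_mexp[OF assms(1,2)])
  finally show ?thesis using mexp_deriv_series[OF assms(1,2), of q B t] by (simp add: mult.commute)
qed

lemma mexp_0: "mexp S q 0 A B = (if A = B then 1 else 0)"
proof -
  have "(\<lambda>k. 0 ^ k / fact k * mpow S q k A B) sums (0 ^ 0 / fact 0 * mpow S q 0 A B)"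
    by (rule sums_single[of 0 "\<lambda>k. 0 ^ k / fact k * mpow S q k A B", THEN sums_cong[THEN iffD1, rotated]]) auto
  then show ?thesis unfolding mexp_def by (simp add: sums_iff)
qed

lemma mexp_sym:
  assumes "finite S" "\<And>C D. q C D = q D C" "A \<in> S" "B \<in> S"
  shows "mexp S q t A B = mexp S q t B A"
  unfolding mexp_def using mpow_sym[OF assms] by simp

section \<open>Duhamel interpolation, uniqueness and comparison\<close>

lemma duhamel_deriv:
  assumes "finite S" "A \<in> S"
    and "\<And>C. C \<in> S \<Longrightarrow> ((\<lambda>s. F s C) has_real_derivative F' s C) (at s)"
  shows "((\<lambda>s. \<Sum>C\<in>S. mexp S q (t - s) A C * F s C) has_real_derivative
     (\<Sum>C\<in>S. mexp S q (t - s) A C * (F' s C - (\<Sum>D\<in>S. q C D * F s D)))) (at s)"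
proof -
  \<comment> \<open>The kernel runs for the remaining time t - s, so the forward equation
    contributes minus the generator. Moved onto \<open>F\<close> by exchanging sums, it leaves the
    propagated defect of \<open>F\<close> in the backward equation.\<close>
  have "((\<lambda>s. \<Sum>C\<in>S. mexp S q (t - s) A C * F s C) has_real_derivative
     (\<Sum>C\<in>S. mexp S q (t - s) A C * F' s C + (\<Sum>D\<in>S. mexp S q (t - s) A D * q D C) * (0 - 1) * F s C)) (at s)"
    by (intro DERIV_sum DERIV_mult' assms DERIV_chain2[OF mexp_forward[OF assms(1,2)]]
          derivative_intros)
  moreover have "(\<Sum>C\<in>S. (\<Sum>D\<in>S. mexp S q (t - s) A D * q D C) * F s C)
    = (\<Sum>C\<in>S. mexp S q (t - s) A C * (\<Sum>D\<in>S. q C D * F s D))"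
    by (simp add: sum_distrib_left sum_distrib_right mult.assoc) (rule sum.swap)
  ultimately show ?thesis
    by (simp add: sum.distrib sum_subtractf right_diff_distrib sum_negf)
qed

lemma duhamel_start:
  assumes "finite S" "A \<in> S"
  shows "(\<Sum>C\<in>S. mexp S q (t - t) A C * F C) = F A"
  using assms by (simp add: mexp_0 if_distrib[where f="\<lambda>x. x * _"] cong: if_cong)

lemma mexp_unique:
  assumes "finite S" "A \<in> S"
    and "\<And>s C. C \<in> S \<Longrightarrow> ((\<lambda>s. F s C) has_real_derivative (\<Sum>D\<in>S. q C D * F s D)) (at s)"
  shows "F t A = (\<Sum>C\<in>S. mexp S q t A C * F 0 C)"
proof -
  let ?g = "\<lambda>s. \<Sum>C\<in>S. mexp S q (t - s) A C * F s C"
  have "(?g has_real_derivative 0) (at s)" for s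
    using duhamel_deriv[OF assms(1,2), where F=F and F'="\<lambda>s C. \<Sum>D\<in>S. q C D * F s D" and s=s and q=q and t=t]
      assms(3) by simp
  then have "?g t = ?g 0" using DERIV_isconst_all by blast
  moreover have "?g t = F t A" using duhamel_start[OF assms(1,2), of q t "F t"] .
  ultimately show ?thesis by simp
qed

text \<open>For fixed t both sides solve the backward equation in s with the same initial data, so
  uniqueness replaces a Cauchy product of series.\<close>

lemma mexp_add:
  assumes "finite S" "A \<in> S"
  shows "mexp S q (s + t) A B = (\<Sum>C\<in>S. mexp S q s A C * mexp S q t C B)"
proof -
  have "((\<lambda>s. mexp S q (s + t) C B) has_real_derivative (\<Sum>D\<in>S. q C D * mexp S q (s + t) D B)) (at s)"
    if "C \<in> S" for s C
    using DERIV_shift[of "\<lambda>s. mexp S q s C B" "\<Sum>D\<in>S. q C D * mexp S q (s + t) D B" s t]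
      mexp_backward[OF assms(1) that] by simp
  from mexp_unique[OF assms, where F="\<lambda>s C. mexp S q (s + t) C B", OF this]
  show ?thesis by simp
qed

text \<open>Uniformization: adding a multiple of the identity makes the generator entrywise nonnegative.\<close>

lemma mexp_nonneg:
  assumes "finite S" "A \<in> S" "B \<in> S" "0 \<le> t"
    and off: "\<And>C D. C \<in> S \<Longrightarrow> D \<in> S \<Longrightarrow> C \<noteq> D \<Longrightarrow> 0 \<le> q C D"
  shows "0 \<le> mexp S q t A B"
proof -
  define c where "c = (\<Sum>C\<in>S. \<bar>q C C\<bar>)"
  define r where "r = (\<lambda>C D. q C D + (if C = D then c else 0))"
  have r0: "0 \<le> r C D" if "C \<in> S" "D \<in> S" for C D
  proof (cases "C = D")
    case True
    have "\<bar>q C C\<bar> \<le> c" unfolding c_def using that assms(1) by (intro member_le_sum) auto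
    then show ?thesis using True by (simp add: r_def)
  qed (use off that in \<open>simp add: r_def\<close>)
  have pos: "0 \<le> mexp S r t A B"
    unfolding mexp_def using assms mpow_nonneg[of S r, OF r0]
    by (intro suminf_nonneg summable_mexp) auto
  \<comment> \<open>The exponential factor undoes the diagonal shift: \<open>F\<close> solves the
    backward equation for \<open>q\<close> with the identity as initial data, so uniqueness
    identifies it with the exponential of \<open>q\<close>.\<close>
  define F where "F = (\<lambda>s C. exp (- (c * s)) * mexp S r s C B)"
  have "((\<lambda>s. F s C) has_real_derivative (\<Sum>D\<in>S. q C D * F s D)) (at s)" if C: "C \<in> S" for s C
  proof -
    have "((\<lambda>s. F s C) has_real_derivative
        exp (- (c * s)) * (\<Sum>D\<in>S. r C D * mexp S r s D B) + - c * exp (- (c * s)) * mexp S r s C B) (at s)"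
      unfolding F_def
      by (rule DERIV_mult'[OF _ mexp_backward[OF assms(1) C]]) (auto intro!: derivative_eq_intros)
    moreover have "(\<Sum>D\<in>S. r C D * mexp S r s D B)
        = (\<Sum>D\<in>S. q C D * mexp S r s D B) + c * mexp S r s C B"
      using assms(1) C
      by (simp add: r_def distrib_right sum.distrib if_distrib[where f="\<lambda>x. x * _"] cong: if_cong)
    ultimately show ?thesis by (simp add: F_def algebra_simps sum_distrib_left)
  qed
  from mexp_unique[OF assms(1,2), where F=F, OF this]
  have "F t A = (\<Sum>C\<in>S. mexp S q t A C * (if C = B then 1 else 0))"
    by (simp add: F_def mexp_0)
  also have "\<dots> = mexp S q t A B" using assms(1,3) by (simp add: if_distrib cong: if_cong)
  finally have "mexp S q t A B = F t A" by simp
  then show ?thesis using pos by (simp add: F_def)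
qed

text \<open>The nonnegative kernel propagates a nonnegative defect, so the Duhamel interpolation
  increases from s = 0 to s = t.\<close>

lemma mexp_supersolution:
  assumes "finite S" "A \<in> S" "0 \<le> t"
    and off: "\<And>C D. C \<in> S \<Longrightarrow> D \<in> S \<Longrightarrow> C \<noteq> D \<Longrightarrow> 0 \<le> q C D"
    and F': "\<And>s C. C \<in> S \<Longrightarrow> 0 \<le> s \<Longrightarrow> ((\<lambda>s. F s C) has_real_derivative F' s C) (at s)"
    and le: "\<And>s C. C \<in> S \<Longrightarrow> 0 \<le> s \<Longrightarrow> (\<Sum>D\<in>S. q C D * F s D) \<le> F' s C"
  shows "(\<Sum>C\<in>S. mexp S q t A C * F 0 C) \<le> F t A"
proof -
  let ?g = "\<lambda>s. \<Sum>C\<in>S. mexp S q (t - s) A C * F s C"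
  have "?g 0 \<le> ?g t"
  proof (rule DERIV_nonneg_imp_nondecreasing[OF assms(3)])
    fix s assume s: "0 \<le> s" "s \<le> t"
    have "(?g has_real_derivative
      (\<Sum>C\<in>S. mexp S q (t - s) A C * (F' s C - (\<Sum>D\<in>S. q C D * F s D)))) (at s)"
      by (rule duhamel_deriv) (use assms F' s in auto)
    moreover have "0 \<le> (\<Sum>C\<in>S. mexp S q (t - s) A C * (F' s C - (\<Sum>D\<in>S. q C D * F s D)))"
      using s assms le by (intro sum_nonneg mult_nonneg_nonneg mexp_nonneg) auto
    ultimately show "\<exists>y. (?g has_real_derivative y) (at s) \<and> 0 \<le> y" by blast
  qed
  moreover have "?g t = F t A" using duhamel_start[OF assms(1,2), of q t "F t"] .
  ultimately show ?thesis by simp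
qed

text \<open>Enlarging the window kills less: seen from \<open>S\<close>, the exponential over
  \<open>S'\<close> is a supersolution, since restricting its backward equation to \<open>S\<close>
  only drops nonnegative terms.\<close>

lemma mexp_mono_set:
  assumes "finite S'" "S \<subseteq> S'" "A \<in> S" "B \<in> S" "0 \<le> t"
    and off: "\<And>C D. C \<in> S' \<Longrightarrow> D \<in> S' \<Longrightarrow> C \<noteq> D \<Longrightarrow> 0 \<le> q C D"
  shows "mexp S q t A B \<le> mexp S' q t A B"
proof -
  have fin: "finite S" using assms finite_subset by blast
  have "(\<Sum>C\<in>S. mexp S q t A C * mexp S' q 0 C B) \<le> mexp S' q t A B"
  proof (rule mexp_supersolution[OF fin assms(3,5), where F="\<lambda>s C. mexp S' q s C B"])
    fix s C assume C: "C \<in> S" and s: "(0::real) \<le> s"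
    show "((\<lambda>s. mexp S' q s C B) has_real_derivative (\<Sum>D\<in>S'. q C D * mexp S' q s D B)) (at s)"
      using mexp_backward[OF assms(1)] C assms(2) by auto
    have "0 \<le> mexp S' q s D B" if "D \<in> S'" for D
      using assms s that by (intro mexp_nonneg off) auto
    then show "(\<Sum>D\<in>S. q C D * mexp S' q s D B) \<le> (\<Sum>D\<in>S'. q C D * mexp S' q s D B)"
      using assms C by (intro sum_mono2 mult_nonneg_nonneg off) auto
  qed (use off assms(2) in auto)
  moreover have "(\<Sum>C\<in>S. mexp S q t A C * mexp S' q 0 C B) = mexp S q t A B"
    using fin assms(4) by (simp add: mexp_0 if_distrib cong: if_cong)
  ultimately show ?thesis by simp
qed

section \<open>The exclusion generator\<close>

lemma trunc_states_iff:
  "A \<in> trunc_states N \<longleftrightarrow> (\<forall>x. x < - int N \<longrightarrow> x \<in> A) \<and> (\<forall>x. x > int N \<longrightarrow> x \<notin> A)"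
proof
  assume A: "A \<in> trunc_states N"
  have "x \<in> {- int N..int N}" if "(x \<in> A) \<noteq> (x < 0)" for x
    using A that unfolding trunc_states_def O_conf_def by blast
  then have *: "(x \<in> A) = (x < 0)" if "x < - int N \<or> x > int N" for x using that by fastforce
  show "(\<forall>x. x < - int N \<longrightarrow> x \<in> A) \<and> (\<forall>x. x > int N \<longrightarrow> x \<notin> A)"
    using * by auto
next
  assume A: "(\<forall>x. x < - int N \<longrightarrow> x \<in> A) \<and> (\<forall>x. x > int N \<longrightarrow> x \<notin> A)"
  then show "A \<in> trunc_states N"
    unfolding trunc_states_def O_conf_def by (auto simp: not_less not_le)
qed

lemma finite_trunc_states: "finite (trunc_states N)"
proof (rule finite_surj[of "Pow {- int N..int N}"])
  show "trunc_states N \<subseteq> (\<lambda>D. (O_conf - D) \<union> (D - O_conf)) ` Pow {- int N..int N}"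
  proof
    fix A assume "A \<in> trunc_states N"
    then have "(A - O_conf) \<union> (O_conf - A) \<in> Pow {- int N..int N}" by (simp add: trunc_states_def)
    moreover have "A = (O_conf - ((A - O_conf) \<union> (O_conf - A))) \<union> (((A - O_conf) \<union> (O_conf - A)) - O_conf)"
      by blast
    ultimately show "A \<in> (\<lambda>D. (O_conf - D) \<union> (D - O_conf)) ` Pow {- int N..int N}" by (rule rev_image_eqI)
  qed
qed simp

lemma trunc_states_mono: "N \<le> N' \<Longrightarrow> trunc_states N \<subseteq> trunc_states N'"
  by (auto simp: trunc_states_iff)

lemma O_conf_trunc: "O_conf \<in> trunc_states N"
  by (auto simp: trunc_states_def)

text \<open>At p = 1/2 right and left jumps become one move: the contents of the sites e and e + 1
  are exchanged at rate 1/2. An edge is named by its left endpoint, and it is active when the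
  exchange changes the configuration.\<close>

definition active_edges :: "int set \<Rightarrow> int set" where
  "active_edges A = {e. (e \<in> A) \<noteq> (e + 1 \<in> A)}"

definition flip_edge :: "int \<Rightarrow> int set \<Rightarrow> int set" where
  "flip_edge e A = (A - {e, e + 1}) \<union> ({e, e + 1} - A)"

lemma flip_edge_mem:
  "x \<in> flip_edge e A \<longleftrightarrow> (if x = e \<or> x = e + 1 then x \<notin> A else x \<in> A)"
  by (auto simp: flip_edge_def)

lemma flip_edge_inj: "flip_edge e A = flip_edge f A \<Longrightarrow> e = f"
proof -
  assume eq: "flip_edge e A = flip_edge f A"
  have "x = e \<or> x = e + 1 \<longleftrightarrow> x = f \<or> x = f + 1" for x
    using eq flip_edge_mem[of x e A] flip_edge_mem[of x f A] by (auto split: if_splits)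
  from this[of e] this[of "e + 1"] show "e = f" by auto
qed

lemma flip_edge_ne: "flip_edge e A \<noteq> A"
  using flip_edge_mem[of e e A] by auto

lemma flip_right: "x \<in> A \<Longrightarrow> x + 1 \<notin> A \<Longrightarrow> insert (x + 1) (A - {x}) = flip_edge x A"
  by (auto simp: flip_edge_def)

lemma flip_left: "x \<in> A \<Longrightarrow> x - 1 \<notin> A \<Longrightarrow> insert (x - 1) (A - {x}) = flip_edge (x - 1) A"
  by (auto simp: flip_edge_def)

lemma sep_rate_half:
  "sep_rate (1/2) A B = (if \<exists>e\<in>active_edges A. B = flip_edge e A then 1/2 else 0)"
proof -
  have R: "(\<exists>x. x \<in> A \<and> x + 1 \<notin> A \<and> B = insert (x + 1) (A - {x})) \<longleftrightarrow>
      (\<exists>e. e \<in> A \<and> e + 1 \<notin> A \<and> B = flip_edge e A)"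
    using flip_right by metis
  have L: "(\<exists>x. x \<in> A \<and> x - 1 \<notin> A \<and> B = insert (x - 1) (A - {x})) \<longleftrightarrow>
      (\<exists>e. e \<notin> A \<and> e + 1 \<in> A \<and> B = flip_edge e A)" (is "?l \<longleftrightarrow> ?r")
  proof
    assume ?l
    then obtain x where "x \<in> A" "x - 1 \<notin> A" "B = insert (x - 1) (A - {x})" by blast
    then show ?r using flip_left[of x A] by (intro exI[of _ "x - 1"]) auto
  next
    assume ?r
    then obtain e where "e \<notin> A" "e + 1 \<in> A" "B = flip_edge e A" by blast
    then show ?l using flip_left[of "e + 1" A] by (intro exI[of _ "e + 1"]) auto
  qed
  define P where "P \<longleftrightarrow> (\<exists>e. e \<in> A \<and> e + 1 \<notin> A \<and> B = flip_edge e A)"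
  define Q where "Q \<longleftrightarrow> (\<exists>e. e \<notin> A \<and> e + 1 \<in> A \<and> B = flip_edge e A)"
  \<comment> \<open>The target determines the flipped edge, so at most one of the two summands of
    \<open>sep_rate\<close> is nonzero and the rates never add up to 1.\<close>
  have "\<not> ((\<exists>e. e \<in> A \<and> e + 1 \<notin> A \<and> B = flip_edge e A) \<and> (\<exists>e. e \<notin> A \<and> e + 1 \<in> A \<and> B = flip_edge e A))"
    using flip_edge_inj by blast
  moreover have "(\<exists>e\<in>active_edges A. B = flip_edge e A) \<longleftrightarrow>
     (\<exists>e. e \<in> A \<and> e + 1 \<notin> A \<and> B = flip_edge e A) \<or> (\<exists>e. e \<notin> A \<and> e + 1 \<in> A \<and> B = flip_edge e A)"
    unfolding active_edges_def by blast
  ultimately show ?thesis unfolding sep_rate_def R L P_def[symmetric] Q_def[symmetric] by auto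
qed

lemma active_edges_trunc: "A \<in> trunc_states N \<Longrightarrow> active_edges A \<subseteq> {- int N - 1..int N}"
proof
  fix e assume A: "A \<in> trunc_states N" and e: "e \<in> active_edges A"
  show "e \<in> {- int N - 1..int N}"
  proof (rule ccontr)
    assume "e \<notin> {- int N - 1..int N}"
    then consider "e < - int N" "e + 1 < - int N" | "e > int N" "e + 1 > int N" by fastforce
    then show False using A e unfolding trunc_states_iff active_edges_def by cases auto
  qed
qed

lemma sep_exit_rate_half:
  assumes "A \<in> trunc_states N"
  shows "sep_exit_rate (1/2) A = real (card (active_edges A)) / 2"
proof -
  have fin: "finite (active_edges A)"
    using active_edges_trunc[OF assms] finite_subset by blast
  let ?R = "{x. x \<in> A \<and> x + 1 \<notin> A}" and ?L = "{x. x \<in> A \<and> x - 1 \<notin> A}"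
  let ?L' = "{x. x \<notin> A \<and> x + 1 \<in> A}"
  have "bij_betw (\<lambda>x. x - 1) ?L ?L'"
    by (rule bij_betw_byWitness[of _ "\<lambda>x. x + 1"]) auto
  then have "card ?L = card ?L'" by (rule bij_betw_same_card)
  moreover have "active_edges A = ?R \<union> ?L'" "?R \<inter> ?L' = {}" by (auto simp: active_edges_def)
  then have "card (active_edges A) = card ?R + card ?L'"
    using fin card_Un_disjoint[of ?R ?L'] by simp
  ultimately show ?thesis by (simp add: sep_exit_rate_def field_simps)
qed

text \<open>Detailed balance with respect to counting measure: flipping the same edge again undoes
  the move, and both moves have rate 1/2.\<close>

lemma sep_gen_sym: "sep_gen (1/2) A B = sep_gen (1/2) B A"
proof -
  have "\<exists>e\<in>active_edges B. A = flip_edge e B" if "\<exists>e\<in>active_edges A. B = flip_edge e A" for A B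
  proof -
    from that obtain e where e: "e \<in> active_edges A" "B = flip_edge e A" by blast
    then have "e \<in> active_edges B" "A = flip_edge e B" by (auto simp: active_edges_def flip_edge_def)
    then show ?thesis by blast
  qed
  then have "sep_rate (1/2) A B = sep_rate (1/2) B A" unfolding sep_rate_half by (smt (verit))
  then show ?thesis by (auto simp: sep_gen_def)
qed

lemma sep_gen_off: "A \<noteq> B \<Longrightarrow> 0 \<le> sep_gen (1/2) A B"
  by (simp add: sep_gen_def sep_rate_half)

text \<open>The diagonal entry is the exit rate of the full process, so a flip that leaves the
  window still loses \<open>f A\<close> but gains 0; this is the killing. The two extra edges -N - 1
  and N are those through which the window can be left.\<close>

lemma sep_gen_apply:
  fixes f :: "int set \<Rightarrow> real"
  assumes A: "A \<in> trunc_states N"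
  shows "(\<Sum>C\<in>trunc_states N. sep_gen (1/2) A C * f C) =
    (\<Sum>e=- int N - 1..int N. if (e \<in> A) \<noteq> (e + 1 \<in> A)
       then ((if flip_edge e A \<in> trunc_states N then f (flip_edge e A) else 0) - f A) / 2 else 0)"
proof -
  let ?T = "trunc_states N" and ?E = "active_edges A"
  have finE: "finite ?E" using active_edges_trunc[OF A] finite_subset by blast
  have "(\<Sum>C\<in>?T. sep_gen (1/2) A C * f C)
      = sep_gen (1/2) A A * f A + (\<Sum>C\<in>?T - {A}. sep_gen (1/2) A C * f C)"
    using finite_trunc_states A by (rule sum.remove)
  also have "(\<Sum>C\<in>?T - {A}. sep_gen (1/2) A C * f C)
      = (\<Sum>C\<in>?T - {A}. if C \<in> (\<lambda>e. flip_edge e A) ` ?E then f C / 2 else 0)"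
    by (rule sum.cong) (auto simp: sep_gen_def sep_rate_half)
  also have "\<dots> = (\<Sum>C\<in>(?T - {A}) \<inter> (\<lambda>e. flip_edge e A) ` ?E. f C / 2)"
    using finite_trunc_states by (intro sum.inter_restrict[symmetric]) auto
  also have "(?T - {A}) \<inter> (\<lambda>e. flip_edge e A) ` ?E = (\<lambda>e. flip_edge e A) ` {e\<in>?E. flip_edge e A \<in> ?T}"
    using flip_edge_ne by auto
  also have "(\<Sum>C\<in>(\<lambda>e. flip_edge e A) ` {e\<in>?E. flip_edge e A \<in> ?T}. f C / 2)
      = (\<Sum>e\<in>{e\<in>?E. flip_edge e A \<in> ?T}. f (flip_edge e A) / 2)"
    by (rule sum.reindex_cong[OF _ refl refl]) (auto intro: inj_onI flip_edge_inj)
  also have "\<dots> = (\<Sum>e\<in>?E. if flip_edge e A \<in> ?T then f (flip_edge e A) / 2 else 0)"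
    using finE by (rule sum.inter_filter)
  also have "sep_gen (1/2) A A * f A = (\<Sum>e\<in>?E. - f A / 2)"
    using sep_exit_rate_half[OF A] by (simp add: sep_gen_def)
  also have "(\<Sum>e\<in>?E. - f A / 2) + (\<Sum>e\<in>?E. if flip_edge e A \<in> ?T then f (flip_edge e A) / 2 else 0)
     = (\<Sum>e\<in>?E. ((if flip_edge e A \<in> ?T then f (flip_edge e A) else 0) - f A) / 2)"
    unfolding sum.distrib[symmetric] by (rule sum.cong) (auto simp: field_simps)
  also have "?E = {e\<in>{- int N - 1..int N}. (e \<in> A) \<noteq> (e + 1 \<in> A)}"
    using active_edges_trunc[OF A] by (auto simp: active_edges_def)
  finally show ?thesis by (subst (asm) sum.inter_filter) auto
qed

lemma flip_edge_trunc:
  "A \<in> trunc_states N \<Longrightarrow> - int N \<le> e \<Longrightarrow> e < int N \<Longrightarrow> flip_edge e A \<in> trunc_states N"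
  by (auto simp: trunc_states_iff flip_edge_mem)

lemma gen_pow_eq_mpow: "gen_pow p N k A B = mpow (trunc_states N) (sep_gen p) k A B"
  by (induction k arbitrary: A) auto

lemma killed_trans_eq_mexp: "killed_trans p N t A B = mexp (trunc_states N) (sep_gen p) t A B"
  by (simp add: killed_trans_def mexp_def gen_pow_eq_mpow)

lemma killed_trans_le_1:
  assumes "A \<in> trunc_states N" "B \<in> trunc_states N" "0 \<le> t"
  shows "killed_trans (1/2) N t A B \<le> 1"
proof -
  let ?T = "trunc_states N"
  have "(\<Sum>D\<in>?T. sep_gen (1/2) C D * 1) \<le> 0" if "C \<in> ?T" for C
    unfolding sep_gen_apply[OF that] by (rule sum_nonpos) simp
  then have "(\<Sum>C\<in>?T. mexp ?T (sep_gen (1/2)) t A C * 1) \<le> 1"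
    by (intro mexp_supersolution[where F="\<lambda>s C. 1" and F'="\<lambda>s C. 0", OF finite_trunc_states assms(1,3)])
       (auto simp: sep_gen_off)
  moreover have "mexp ?T (sep_gen (1/2)) t A B \<le> (\<Sum>C\<in>?T. mexp ?T (sep_gen (1/2)) t A C)"
    using assms finite_trunc_states by (intro member_le_sum mexp_nonneg) (auto simp: sep_gen_off)
  ultimately show ?thesis by (simp add: killed_trans_eq_mexp)
qed

text \<open>\<open>prob_return\<close> is defined by \<open>lim\<close>, which says something only
  once convergence is known; here it comes from monotonicity in the window and the bound 1.\<close>

lemma killed_trans_tendsto:
  assumes "0 \<le> t"
  shows "(\<lambda>N. killed_trans (1/2) N t O_conf O_conf) \<longlonglongrightarrow> prob_return (1/2) t"
proof -
  have "incseq (\<lambda>N. killed_trans (1/2) N t O_conf O_conf)"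
    unfolding killed_trans_eq_mexp
    by (intro incseq_SucI mexp_mono_set finite_trunc_states trunc_states_mono O_conf_trunc assms sep_gen_off) auto
  moreover have "bdd_above (range (\<lambda>N. killed_trans (1/2) N t O_conf O_conf))"
    using killed_trans_le_1[OF O_conf_trunc O_conf_trunc assms] by (auto intro!: bdd_aboveI[of _ 1])
  ultimately have "convergent (\<lambda>N. killed_trans (1/2) N t O_conf O_conf)"
    using LIMSEQ_incseq_SUP convergentI by blast
  then show ?thesis unfolding prob_return_def by (rule convergent_LIMSEQ_iff[THEN iffD1])
qed

section \<open>Comparison with independent particles\<close>

text \<open>On an edge with both endpoints occupied the product gains a term proportional to
  (u(e+1) - u(e))^2 over the exclusion dynamics; on every other edge inside the window both agree.\<close>

lemma product_supersolution_edge: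
  fixes u :: "int \<Rightarrow> real"
  assumes A: "A \<in> trunc_states N" and e: "e \<in> {- int N - 1..int N}"
    and u0: "\<And>x. 0 \<le> u x" and dec: "\<And>x. u (x + 1) \<le> u x"
  defines "W \<equiv> {- int N..int N}"
  shows "(if (e \<in> A) \<noteq> (e + 1 \<in> A) then
      ((if flip_edge e A \<in> trunc_states N then (\<Prod>x\<in>flip_edge e A \<inter> W. u x) else 0) - (\<Prod>x\<in>A \<inter> W. u x)) / 2 else 0)
    \<le> ((if e \<in> A \<inter> W then (\<Prod>y\<in>A \<inter> W - {e}. u y) * (u (e + 1) - u e) else 0)
      + (if e + 1 \<in> A \<inter> W then (\<Prod>y\<in>A \<inter> W - {e + 1}. u y) * (u e - u (e + 1)) else 0)) / 2"
proof -
  have finW: "finite (B \<inter> W)" for B by (simp add: W_def)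
  have nn: "0 \<le> (\<Prod>x\<in>B. u x)" for B by (rule prod_nonneg) (simp add: u0)
  have out: "x \<in> A \<longleftrightarrow> x < 0" if "x \<notin> W" for x
    using A that unfolding trunc_states_iff W_def by fastforce
  have rem: "(\<Prod>x\<in>A \<inter> W. u x) = u z * (\<Prod>x\<in>A \<inter> W - {z}. u x)" if "z \<in> A \<inter> W" for z
    using finW that by (rule prod.remove)
  consider (left) "e = - int N - 1" | (right) "e = int N" | (mid) "- int N \<le> e" "e < int N"
    using e by fastforce
  then show ?thesis
  proof cases
    \<comment> \<open>The outer site is occupied and carries no factor. If its neighbour is occupied
      too, the right side is nonnegative because \<open>u\<close> decreases; otherwise the flip is
      killed and the left side is nonpositive.\<close>
    case left
    then have "e \<in> A" "e \<notin> W" using out[of e] by (auto simp: W_def)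
    moreover have "flip_edge e A \<notin> trunc_states N" if "e + 1 \<notin> A"
      using left that \<open>e \<in> A\<close> by (auto simp: trunc_states_iff flip_edge_mem)
    ultimately show ?thesis using nn[of "A \<inter> W"] nn[of "A \<inter> W - {e + 1}"] dec[of e] left by (auto simp: W_def)
  next
    case right
    then have "e + 1 \<notin> A" "e \<in> W" using out[of "e + 1"] by (auto simp: W_def)
    moreover have "flip_edge e A \<notin> trunc_states N" if "e \<in> A"
      using right that \<open>e + 1 \<notin> A\<close> by (auto simp: trunc_states_iff flip_edge_mem)
    ultimately show ?thesis using rem[of e] nn[of "A \<inter> W - {e}"] u0[of "e + 1"]
      by (auto simp: algebra_simps)
  next
    case mid
    then have W: "e \<in> W" "e + 1 \<in> W" by (auto simp: W_def)
    have T: "flip_edge e A \<in> trunc_states N" using flip_edge_trunc[OF A] mid by auto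
    consider (RR) "e \<in> A" "e + 1 \<in> A" | (R0) "e \<in> A" "e + 1 \<notin> A" | (L0) "e \<notin> A" "e + 1 \<in> A"
      | (N0) "e \<notin> A" "e + 1 \<notin> A" by blast
    then show ?thesis
    proof cases
      case RR
      define r where "r = (\<Prod>x\<in>A \<inter> W - {e} - {e + 1}. u x)"
      have 1: "(\<Prod>y\<in>A \<inter> W - {e}. u y) = u (e + 1) * r"
        unfolding r_def using RR W finW by (intro prod.remove) auto
      have "(\<Prod>y\<in>A \<inter> W - {e + 1}. u y) = u e * (\<Prod>y\<in>A \<inter> W - {e + 1} - {e}. u y)"
        using RR W finW by (intro prod.remove) auto
      moreover have "A \<inter> W - {e + 1} - {e} = A \<inter> W - {e} - {e + 1}" by auto
      ultimately have 2: "(\<Prod>y\<in>A \<inter> W - {e + 1}. u y) = u e * r" by (simp add: r_def)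
      have "0 \<le> r * (u (e + 1) - u e)\<^sup>2" unfolding r_def using nn by simp
      then show ?thesis using RR W 1 2 by (simp add: power2_eq_square algebra_simps)
    next
      case R0
      have "flip_edge e A \<inter> W = insert (e + 1) (A \<inter> W - {e})"
        using R0 W by (auto simp: flip_edge_def)
      then have "(\<Prod>x\<in>flip_edge e A \<inter> W. u x) = u (e + 1) * (\<Prod>x\<in>A \<inter> W - {e}. u x)"
        using R0 finW by simp
      then show ?thesis using R0 W T rem[of e] by (simp add: algebra_simps)
    next
      case L0
      have "flip_edge e A \<inter> W = insert e (A \<inter> W - {e + 1})"
        using L0 W by (auto simp: flip_edge_def)
      then have "(\<Prod>x\<in>flip_edge e A \<inter> W. u x) = u e * (\<Prod>x\<in>A \<inter> W - {e + 1}. u x)"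
        using L0 finW by simp
      then show ?thesis using L0 W T rem[of "e + 1"] by (simp add: algebra_simps)
    qed simp
  qed
qed

text \<open>Each Laplacian is split into the differences along its two edges, and the difference to
  the left neighbour is reindexed by that edge. The edges from -N - 1 to N are exactly those
  touching the window.\<close>

lemma laplacian_by_edges:
  fixes u P :: "int \<Rightarrow> real"
  assumes "B \<subseteq> {- int N..int N}"
  shows "(\<Sum>x\<in>B. P x * (u (x + 1) + u (x - 1) - 2 * u x) / 2) =
    (\<Sum>e=- int N - 1..int N. ((if e \<in> B then P e * (u (e + 1) - u e) else 0)
      + (if e + 1 \<in> B then P (e + 1) * (u e - u (e + 1)) else 0)) / 2)"
proof -
  let ?E = "{- int N - 1..int N}"
  have 1: "(\<Sum>e\<in>?E. if e \<in> B then P e * (u (e + 1) - u e) else 0) = (\<Sum>x\<in>B. P x * (u (x + 1) - u x))"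
  proof -
    have "?E \<inter> B = B" using assms by auto
    then show ?thesis using sum.inter_restrict[of ?E "\<lambda>e. P e * (u (e + 1) - u e)" B] by simp
  qed
  have 2: "(\<Sum>e\<in>?E. if e + 1 \<in> B then P (e + 1) * (u e - u (e + 1)) else 0) = (\<Sum>x\<in>B. P x * (u (x - 1) - u x))"
  proof -
    have "(\<Sum>e\<in>?E. if e + 1 \<in> B then P (e + 1) * (u e - u (e + 1)) else 0)
       = (\<Sum>x=- int N..int N + 1. if x \<in> B then P x * (u (x - 1) - u x) else 0)"
      by (rule sum.reindex_bij_witness[where i="\<lambda>x. x - 1" and j="\<lambda>e. e + 1"]) auto
    moreover have "{- int N..int N + 1} \<inter> B = B" using assms by auto
    ultimately show ?thesis
      using sum.inter_restrict[of "{- int N..int N + 1}" "\<lambda>x. P x * (u (x - 1) - u x)" B] by simp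
  qed
  show ?thesis
    unfolding sum_divide_distrib[symmetric] sum.distrib 1 2
    unfolding sum.distrib[symmetric] by (intro arg_cong2[where f="(/)"] sum.cong) (auto simp: algebra_simps)
qed

lemma killed_trans_upper:
  fixes u u' :: "real \<Rightarrow> int \<Rightarrow> real"
  assumes t: "0 \<le> t"
    and u': "\<And>s x. 0 \<le> s \<Longrightarrow> ((\<lambda>s. u s x) has_real_derivative u' s x) (at s)"
    and heat: "\<And>s x. 0 \<le> s \<Longrightarrow> (u s (x + 1) + u s (x - 1) - 2 * u s x) / 2 \<le> u' s x"
    and u0: "\<And>s x. 0 \<le> s \<Longrightarrow> 0 \<le> u s x" and dec: "\<And>s x. 0 \<le> s \<Longrightarrow> u s (x + 1) \<le> u s x"
    and init: "\<And>x. x < 0 \<Longrightarrow> 1 \<le> u 0 x"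
  shows "killed_trans (1/2) N t O_conf O_conf \<le> (\<Prod>x=- int N..-1. u t x)"
proof -
  let ?T = "trunc_states N" and ?W = "{- int N..int N}" and ?q = "sep_gen (1/2)"
  \<comment> \<open>Sites left of the window are always occupied and would give an infinite product;
    they are left out, which the estimate at the boundary edge permits.\<close>
  define F where "F = (\<lambda>s A. \<Prod>x\<in>A \<inter> ?W. u s x)"
  define F' where "F' = (\<lambda>s A. \<Sum>x\<in>A \<inter> ?W. u' s x * (\<Prod>y\<in>A \<inter> ?W - {x}. u s y))"
  have main: "(\<Sum>C\<in>?T. mexp ?T ?q t O_conf C * F 0 C) \<le> F t O_conf"
  proof (rule mexp_supersolution[where F'=F', OF finite_trunc_states O_conf_trunc t])
    fix s A assume A: "A \<in> ?T" and s: "(0::real) \<le> s"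
    show "((\<lambda>s. F s A) has_real_derivative F' s A) (at s)"
      unfolding F_def F'_def using u'[OF s] by (intro has_field_derivative_prod) auto
    have "(\<Sum>D\<in>?T. ?q A D * F s D) \<le> (\<Sum>e=- int N - 1..int N.
      ((if e \<in> A \<inter> ?W then (\<Prod>y\<in>A \<inter> ?W - {e}. u s y) * (u s (e + 1) - u s e) else 0)
      + (if e + 1 \<in> A \<inter> ?W then (\<Prod>y\<in>A \<inter> ?W - {e + 1}. u s y) * (u s e - u s (e + 1)) else 0)) / 2)"
      unfolding sep_gen_apply[OF A] F_def
      by (intro sum_mono product_supersolution_edge A u0 dec s)
    also have "\<dots> = (\<Sum>x\<in>A \<inter> ?W. (\<Prod>y\<in>A \<inter> ?W - {x}. u s y) * (u s (x + 1) + u s (x - 1) - 2 * u s x) / 2)"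
      by (rule laplacian_by_edges[symmetric]) auto
    also have "\<dots> \<le> F' s A"
      unfolding F'_def
    proof (rule sum_mono)
      fix x
      have "(\<Prod>y\<in>A \<inter> ?W - {x}. u s y) * ((u s (x + 1) + u s (x - 1) - 2 * u s x) / 2)
         \<le> (\<Prod>y\<in>A \<inter> ?W - {x}. u s y) * u' s x"
        using heat[OF s] u0[OF s] by (intro mult_left_mono prod_nonneg) auto
      then show "(\<Prod>y\<in>A \<inter> ?W - {x}. u s y) * (u s (x + 1) + u s (x - 1) - 2 * u s x) / 2
         \<le> u' s x * (\<Prod>y\<in>A \<inter> ?W - {x}. u s y)" by (simp add: mult.commute)
    qed
    finally show "(\<Sum>D\<in>?T. ?q A D * F s D) \<le> F' s A" .
  qed (simp add: sep_gen_off)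
  have OW: "O_conf \<inter> ?W = {- int N..-1}" by (auto simp: O_conf_def)
  have K0: "0 \<le> mexp ?T ?q t O_conf C" if "C \<in> ?T" for C
    using that t by (intro mexp_nonneg finite_trunc_states O_conf_trunc) (auto simp: sep_gen_off)
  \<comment> \<open>From the whole sum only the term at \<open>O_conf\<close> is kept; its weight is
    at least 1 and all others are nonnegative.\<close>
  have "1 \<le> F 0 O_conf" unfolding F_def OW using init by (intro prod_ge_1) auto
  then have "mexp ?T ?q t O_conf O_conf \<le> mexp ?T ?q t O_conf O_conf * F 0 O_conf"
    using K0[OF O_conf_trunc] by (simp add: mult_le_cancel_left1)
  also have "\<dots> \<le> (\<Sum>C\<in>?T. mexp ?T ?q t O_conf C * F 0 C)"
    using O_conf_trunc finite_trunc_states K0 u0[of 0]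
    by (intro member_le_sum[of _ _ "\<lambda>C. mexp ?T ?q t O_conf C * F 0 C"] mult_nonneg_nonneg)
       (auto simp: F_def intro!: prod_nonneg)
  also note main
  finally show ?thesis by (simp add: killed_trans_eq_mexp F_def OW)
qed

text \<open>Factors are at most 1, so the product may be shortened to a length m before the window
  grows. This leaves m free to be chosen depending on t.\<close>

lemma prob_return_upper:
  fixes u u' :: "real \<Rightarrow> int \<Rightarrow> real"
  assumes t: "0 \<le> t"
    and u': "\<And>s x. 0 \<le> s \<Longrightarrow> ((\<lambda>s. u s x) has_real_derivative u' s x) (at s)"
    and heat: "\<And>s x. 0 \<le> s \<Longrightarrow> (u s (x + 1) + u s (x - 1) - 2 * u s x) / 2 \<le> u' s x"
    and u0: "\<And>s x. 0 \<le> s \<Longrightarrow> 0 \<le> u s x" and dec: "\<And>s x. 0 \<le> s \<Longrightarrow> u s (x + 1) \<le> u s x"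
    and init: "\<And>x. x < 0 \<Longrightarrow> 1 \<le> u 0 x"
    and u1: "\<And>s x. 0 \<le> s \<Longrightarrow> u s x \<le> 1"
  shows "prob_return (1/2) t \<le> (\<Prod>x=- int m..-1. u t x)"
proof (rule LIMSEQ_le_const2[OF killed_trans_tendsto[OF t]], intro exI allI impI)
  fix n assume "m \<le> n"
  have "killed_trans (1/2) n t O_conf O_conf \<le> (\<Prod>x=- int n..-1. u t x)"
    by (rule killed_trans_upper[OF t u' heat u0 dec init])
  also have "\<dots> = (\<Prod>x\<in>{- int n..-1} - {- int m..-1}. u t x) * (\<Prod>x=- int m..-1. u t x)"
    using \<open>m \<le> n\<close> by (intro prod.subset_diff) auto
  also have "\<dots> \<le> 1 * (\<Prod>x=- int m..-1. u t x)"
    using u0[OF t] u1[OF t] by (intro mult_right_mono prod_le_1 prod_nonneg) auto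
  finally show "killed_trans (1/2) n t O_conf O_conf \<le> (\<Prod>x=- int m..-1. u t x)" by simp
qed

section \<open>The discrete heat equation\<close>

text \<open>The probability that a discrete-time simple random walk started at x is negative after k
  steps.\<close>

primrec step_avg :: "nat \<Rightarrow> int \<Rightarrow> real" where
  "step_avg 0 x = (if x < 0 then 1 else 0)"
| "step_avg (Suc k) x = (step_avg k (x + 1) + step_avg k (x - 1)) / 2"

lemma step_avg_bounds: "0 \<le> step_avg k x" "step_avg k x \<le> 1"
proof -
  have "0 \<le> step_avg k x \<and> step_avg k x \<le> 1"
  proof (induction k arbitrary: x)
    case (Suc k)
    from Suc[of "x + 1"] Suc[of "x - 1"] show ?case by simp
  qed simp
  then show "0 \<le> step_avg k x" "step_avg k x \<le> 1" by auto
qed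

lemma step_avg_dec: "step_avg k (x + 1) \<le> step_avg k x"
proof (induction k arbitrary: x)
  case (Suc k)
  from Suc[of "x + 1"] Suc[of "x - 1"] show ?case by simp
qed simp

text \<open>The probability that a rate-one simple random walk started at x is negative at time t.\<close>

definition walk_neg_prob :: "real \<Rightarrow> int \<Rightarrow> real" where
  "walk_neg_prob t x = exp (- t) * (\<Sum>k. t ^ k / fact k * step_avg k x)"

lemma step_avg_abs: "\<bar>step_avg k x\<bar> \<le> 1 ^ k"
  using step_avg_bounds[of k x] by simp

lemma summable_step_avg: "summable (\<lambda>k. t ^ k / fact k * step_avg k x)"
  by (rule summable_exp_bounded[OF step_avg_abs])

lemma walk_neg_prob_deriv:
  "((\<lambda>t. walk_neg_prob t x) has_real_derivative
     (walk_neg_prob t (x + 1) + walk_neg_prob t (x - 1) - 2 * walk_neg_prob t x) / 2) (at t)"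
proof -
  have "(\<Sum>k. t ^ k / fact k * step_avg (Suc k) x)
     = (\<Sum>k. (t ^ k / fact k * step_avg k (x + 1) + t ^ k / fact k * step_avg k (x - 1)) / 2)"
    by (simp add: algebra_simps)
  also have "\<dots> = ((\<Sum>k. t ^ k / fact k * step_avg k (x + 1)) + (\<Sum>k. t ^ k / fact k * step_avg k (x - 1))) / 2"
    using summable_step_avg[of t "x + 1"] summable_step_avg[of t "x - 1"]
    by (subst suminf_divide) (auto intro!: summable_add simp: suminf_add)
  finally have eq: "(\<Sum>k. t ^ k / fact k * step_avg (Suc k) x) = \<dots>" .
  have "((\<lambda>t. walk_neg_prob t x) has_real_derivative
     exp (- t) * (\<Sum>k. t ^ k / fact k * step_avg (Suc k) x)
     + - exp (- t) * (\<Sum>k. t ^ k / fact k * step_avg k x)) (at t)"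
    unfolding walk_neg_prob_def
    by (rule DERIV_mult'[OF _ exp_series_deriv[OF step_avg_abs]]) (auto intro!: derivative_eq_intros)
  then show ?thesis
    by (rule DERIV_cong) (simp only: eq walk_neg_prob_def, simp add: field_simps)
qed

lemma walk_neg_prob_0: "walk_neg_prob 0 x = (if x < 0 then 1 else 0)"
proof -
  have "(\<lambda>k. 0 ^ k / fact k * step_avg k x) sums (0 ^ 0 / fact 0 * step_avg 0 x)"
    by (rule sums_single[of 0 "\<lambda>k. 0 ^ k / fact k * step_avg k x", THEN sums_cong[THEN iffD1, rotated]]) auto
  then show ?thesis unfolding walk_neg_prob_def by (simp add: sums_iff)
qed

lemma walk_neg_prob_nonneg: "0 \<le> t \<Longrightarrow> 0 \<le> walk_neg_prob t x"
  unfolding walk_neg_prob_def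
  by (intro mult_nonneg_nonneg suminf_nonneg summable_step_avg) (auto simp: step_avg_bounds)

lemma walk_neg_prob_dec: "0 \<le> t \<Longrightarrow> walk_neg_prob t (x + 1) \<le> walk_neg_prob t x"
  unfolding walk_neg_prob_def
  by (intro mult_left_mono suminf_le summable_step_avg) (auto simp: step_avg_dec)

lemma walk_neg_prob_le_1: 
  assumes "0 \<le> t" shows "walk_neg_prob t x \<le> 1"
proof -
  have s: "summable (\<lambda>k. t ^ k / fact k * 1)" by (rule summable_exp_bounded[of _ 1]) simp
  have "(\<Sum>k. t ^ k / fact k * step_avg k x) \<le> (\<Sum>k. t ^ k / fact k * 1)"
    using assms s by (intro suminf_le summable_step_avg mult_left_mono) (auto simp: step_avg_bounds)
  also have "\<dots> = exp t" by (simp add: exp_def divide_inverse mult.commute)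
  finally have "exp (- t) * (\<Sum>k. t ^ k / fact k * step_avg k x) \<le> exp (- t) * exp t"
    by (intro mult_left_mono) auto
  then show ?thesis by (simp add: walk_neg_prob_def exp_minus)
qed

text \<open>Multiplying by exp s removes the diagonal; a lower bound -B then improves to -B s^n / n!
  for every n by repeated integration.\<close>

lemma heat_minimum_principle:
  fixes D D' :: "real \<Rightarrow> int \<Rightarrow> real"
  assumes D': "\<And>s x. 0 \<le> s \<Longrightarrow> ((\<lambda>s. D s x) has_real_derivative D' s x) (at s)"
    and heat: "\<And>s x. 0 \<le> s \<Longrightarrow> (D s (x + 1) + D s (x - 1) - 2 * D s x) / 2 \<le> D' s x"
    and bound: "\<And>s x. 0 \<le> s \<Longrightarrow> - B \<le> D s x"
    and init: "\<And>x. 0 \<le> D 0 x" and B: "0 \<le> B" and t: "0 \<le> t"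
  shows "0 \<le> D t x"
proof -
  define C where "C = B * exp t"
  have it: "- (C * s ^ n / fact n) \<le> exp s * D s x" if "0 \<le> s" "s \<le> t" for s x n
    using that
  proof (induction n arbitrary: s x)
    case 0
    have "B * exp s \<le> C" unfolding C_def using 0 B by (intro mult_left_mono) auto
    moreover have "exp s * (- B) \<le> exp s * D s x" using bound 0 by (intro mult_left_mono) auto
    ultimately show ?case by (simp add: mult.commute)
  next
    case (Suc n)
    \<comment> \<open>The added term is the primitive of the previous bound. The two neighbours
      enter with weight 1/2 each and are bounded below by the induction hypothesis, so the
      derivative of \<open>?g\<close> is nonnegative.\<close>
    let ?g = "\<lambda>s. exp s * D s x + C * s ^ Suc n / fact (Suc n)"
    have "?g 0 \<le> ?g s"
    proof (rule DERIV_nonneg_imp_nondecreasing[OF Suc.prems(1)])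
      fix r assume r: "0 \<le> r" "r \<le> s"
      have eq: "C * (real (Suc n) * r ^ n) / fact (Suc n) = C * r ^ n / fact n"
        by (simp add: field_simps del: of_nat_Suc)
      have "(?g has_real_derivative exp r * D' r x + exp r * D r x + C * (real (Suc n) * r ^ n) / fact (Suc n)) (at r)"
        by (intro DERIV_add DERIV_mult' DERIV_cdivide DERIV_cmult DERIV_exp D' r)
           (use DERIV_pow[of "Suc n" r UNIV] in \<open>simp del: of_nat_Suc power_Suc\<close>)
      then have g: "(?g has_real_derivative exp r * D' r x + exp r * D r x + C * r ^ n / fact n) (at r)"
        unfolding eq .
      have "exp r * ((D r (x + 1) + D r (x - 1) - 2 * D r x) / 2) \<le> exp r * D' r x"
        using heat[OF r(1)] by (intro mult_left_mono) auto
      moreover have "- (C * r ^ n / fact n) \<le> exp r * D r (x + 1)" "- (C * r ^ n / fact n) \<le> exp r * D r (x - 1)"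
        using r Suc.prems by (auto intro!: Suc.IH)
      moreover have "exp r * ((D r (x + 1) + D r (x - 1) - 2 * D r x) / 2)
          = (exp r * D r (x + 1) + exp r * D r (x - 1)) / 2 - exp r * D r x" by (simp add: field_simps)
      moreover have "0 \<le> d' + d + c" if "l \<le> d'" "- c \<le> p" "- c \<le> q" "l = (p + q) / 2 - d" for l d d' c p q :: real
        using that by argo
      ultimately have "0 \<le> exp r * D' r x + exp r * D r x + C * r ^ n / fact n" by blast
      with g show "\<exists>y. (?g has_real_derivative y) (at r) \<and> 0 \<le> y" by blast
    qed
    then show ?case using init[of x] by simp
  qed
  have "(\<lambda>n. - (C * (inverse (fact n) * t ^ n))) \<longlonglongrightarrow> - (C * 0)"
    by (intro tendsto_intros summable_LIMSEQ_zero summable_exp)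
  then have "(\<lambda>n. - (C * t ^ n / fact n)) \<longlonglongrightarrow> 0" by (simp add: field_simps)
  then have "0 \<le> exp t * D t x"
    by (rule LIMSEQ_le_const2) (use it[of t] t in auto)
  then show ?thesis by (simp add: zero_le_mult_iff)
qed

section \<open>The normal distribution function\<close>

lemma std_normal_cdf_eq_cdf: "std_normal_cdf x = cdf std_normal_distribution x"
proof -
  have "cdf std_normal_distribution x = enn2real (\<integral>\<^sup>+y. ennreal (std_normal_density y * indicator {..x} y) \<partial>lborel)"
    by (simp add: cdf_def measure_def emeasure_density ennreal_mult'' ennreal_indicator)
  also have "\<dots> = (LINT y|lborel. std_normal_density y * indicator {..x} y)"
    by (subst integral_eq_nn_integral) auto
  finally show ?thesis by (simp add: std_normal_cdf_def set_lebesgue_integral_def mult.commute)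
qed

lemma std_normal_cdf_diff:
  assumes "x \<le> y"
  shows "std_normal_cdf y - std_normal_cdf x = integral {x..y} std_normal_density"
proof -
  have int: "set_integrable lborel A std_normal_density" if "A \<in> sets lborel" for A
    unfolding set_integrable_def using that
    by (intro integrable_mult_indicator integrable_normal_density) auto
  have "{..y} = {..x} \<union> {x<..y}" using assms by auto
  then have "std_normal_cdf y = std_normal_cdf x + (LINT z:{x<..y}|lborel. std_normal_density z)"
    unfolding std_normal_cdf_def by (simp, intro set_integral_Un int) auto
  also have "(LINT z:{x<..y}|lborel. std_normal_density z) = (LINT z:{x..y}|lborel. std_normal_density z)"
  proof (rule set_integral_null_delta)
    have "sym_diff {x<..y} {x..y} = {x}" using assms by auto
    then show "sym_diff {x<..y} {x..y} \<in> null_sets lborel" by (simp add: null_sets_def)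
  qed (auto intro!: int)
  also have "\<dots> = integral {x..y} std_normal_density"
    by (intro set_borel_integral_eq_integral int) auto
  finally show ?thesis by simp
qed

lemma std_normal_density_deriv:
  "(std_normal_density has_real_derivative - x * std_normal_density x) (at x)"
proof -
  have "((\<lambda>x. 1 / sqrt (2 * pi) * exp (- x\<^sup>2 / 2)) has_real_derivative
      1 / sqrt (2 * pi) * (exp (- x\<^sup>2 / 2) * (- x))) (at x)"
    by (intro DERIV_cmult) (auto intro!: derivative_eq_intros)
  then show ?thesis unfolding std_normal_density_def[abs_def] by (simp add: mult_ac)
qed

lemma std_normal_cdf_deriv: "(std_normal_cdf has_real_derivative std_normal_density x) (at x)"
proof -
  have c: "continuous_on {x - 1..x + 1} std_normal_density"
    by (intro continuous_at_imp_continuous_on ballI DERIV_isCont[OF std_normal_density_deriv])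
  have "((\<lambda>y. integral {x - 1..y} std_normal_density) has_real_derivative std_normal_density x) (at x within {x - 1..x + 1})"
    by (rule integral_has_real_derivative[OF c]) auto
  then have "((\<lambda>y. std_normal_cdf (x - 1) + integral {x - 1..y} std_normal_density) has_real_derivative 0 + std_normal_density x) (at x within {x - 1..x + 1})"
    by (intro DERIV_add DERIV_const)
  then have "(std_normal_cdf has_real_derivative std_normal_density x) (at x within {x - 1..x + 1})"
  proof (rule has_field_derivative_transform_within[where d=1 and g=std_normal_cdf and S="{x - 1..x + 1}", THEN DERIV_cong])
    fix y assume "y \<in> {x - 1..x + 1}"
    then show "std_normal_cdf (x - 1) + integral {x - 1..y} std_normal_density = std_normal_cdf y"
      using std_normal_cdf_diff[of "x - 1" y] by simp
  qed auto
  then show ?thesis using at_within_Icc_at[of "x - 1" x "x + 1"] by simp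
qed

lemma std_normal_cdf_strict_mono: "x < y \<Longrightarrow> std_normal_cdf x < std_normal_cdf y"
  by (rule DERIV_pos_imp_increasing, assumption)
     (use std_normal_cdf_deriv normal_density_pos[of 1 0] in \<open>metis zero_less_one\<close>)

lemma std_normal_cdf_mono: "x \<le> y \<Longrightarrow> std_normal_cdf x \<le> std_normal_cdf y"
  using std_normal_cdf_strict_mono[of x y] by (cases "x = y") auto

lemma real_distribution_std_normal: "real_distribution std_normal_distribution"
  by (simp add: real_dist_normal_dist)

lemma std_normal_cdf_pos: "0 < std_normal_cdf x"
  using std_normal_cdf_strict_mono[of "x - 1" x] by (simp add: std_normal_cdf_eq_cdf cdf_def) (meson measure_nonneg le_less_trans)

lemma std_normal_cdf_less_1: "std_normal_cdf x < 1"
proof -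
  interpret real_distribution std_normal_distribution by (rule real_distribution_std_normal)
  have "std_normal_cdf (x + 1) \<le> 1" unfolding std_normal_cdf_eq_cdf by (rule cdf_bounded_prob)
  then show ?thesis using std_normal_cdf_strict_mono[of x "x + 1"] by simp
qed

lemma std_normal_cdf_tendsto_1: "(std_normal_cdf \<longlongrightarrow> 1) at_top"
proof -
  interpret real_distribution std_normal_distribution by (rule real_distribution_std_normal)
  show ?thesis using cdf_lim_at_top_prob by (simp add: std_normal_cdf_eq_cdf[abs_def])
qed

section \<open>The Gaussian profile under the discrete Laplacian\<close>

lemma std_normal_fourth_deriv_bound: "\<bar>(3 * x - x ^ 3) * std_normal_density x\<bar> \<le> 12"
proof -
  \<comment> \<open>The function to be bounded is the fourth derivative of the normal distribution
    function. The quadratic Taylor polynomial of exp at x^2 / 2 has degree 4 in x, enough to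
    dominate the cubic factor.\<close>
  have "1 + x\<^sup>2 / 2 + (x\<^sup>2 / 2)\<^sup>2 / 2 \<le> exp (x\<^sup>2 / 2)"
    by (rule exp_lower_Taylor_quadratic) simp
  moreover have "\<bar>3 * x - x ^ 3\<bar> \<le> 12 * (1 + x\<^sup>2 / 2 + (x\<^sup>2 / 2)\<^sup>2 / 2)"
  proof -
    have "\<bar>3 * x - x ^ 3\<bar> = \<bar>x\<bar> * \<bar>3 - x\<^sup>2\<bar>"
      by (simp add: abs_mult[symmetric] power3_eq_cube power2_eq_square algebra_simps)
    also have "\<dots> \<le> (1 + x\<^sup>2) * (3 + x\<^sup>2)"
    proof (rule mult_mono)
      have "0 \<le> (\<bar>x\<bar> - 1)\<^sup>2" "0 \<le> x\<^sup>2" by simp_all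
      then show "\<bar>x\<bar> \<le> 1 + x\<^sup>2" by (simp add: power2_diff)
      show "\<bar>3 - x\<^sup>2\<bar> \<le> 3 + x\<^sup>2" using \<open>0 \<le> x\<^sup>2\<close> by linarith
    qed auto
    also have "\<dots> \<le> 12 * (1 + x\<^sup>2 / 2 + (x\<^sup>2 / 2)\<^sup>2 / 2)"
    proof -
      define z where "z = x\<^sup>2"
      have "(1 + z) * (3 + z) + (9 + 2 * z + z\<^sup>2 / 2) = 12 * (1 + z / 2 + (z / 2)\<^sup>2 / 2)"
        by (simp add: power2_eq_square algebra_simps)
      moreover have "0 \<le> 9 + 2 * z + z\<^sup>2 / 2" by (simp add: z_def)
      ultimately show ?thesis unfolding z_def[symmetric] by linarith
    qed
    finally show ?thesis .
  qed
  moreover have "p \<le> 12 * r" if "q \<le> r" "p \<le> 12 * q" for p q r :: real using that by simp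
  ultimately have "\<bar>3 * x - x ^ 3\<bar> \<le> 12 * exp (x\<^sup>2 / 2)" by blast
  moreover have "std_normal_density x \<le> exp (- (x\<^sup>2 / 2))"
  proof -
    have "1 \<le> sqrt (2 * pi)" using pi_ge_two by simp
    then show ?thesis by (simp add: std_normal_density_def divide_le_eq)
  qed
  ultimately have "\<bar>3 * x - x ^ 3\<bar> * std_normal_density x \<le> (12 * exp (x\<^sup>2 / 2)) * exp (- (x\<^sup>2 / 2))"
    by (intro mult_mono) auto
  also have "12 * exp (x\<^sup>2 / 2) * exp (- (x\<^sup>2 / 2)) = 12"
    by (simp add: mult.assoc flip: exp_add)
  finally show ?thesis by (simp add: abs_mult)
qed

text \<open>Taylor expansion of the even function z -> Phi(y + z) + Phi(y - z): its odd derivatives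
  vanish at 0. The fourth is at most 12 + 12 = 4!, whence the coefficient 1 of h^4.\<close>

lemma std_normal_cdf_second_difference:
  "std_normal_cdf (y + h) + std_normal_cdf (y - h) - 2 * std_normal_cdf y
     \<le> h\<^sup>2 * (- y * std_normal_density y) + h ^ 4" if h: "0 < h"
proof -
  let ?p = "std_normal_density"
  define d :: "nat \<Rightarrow> real \<Rightarrow> real" where
    "d m x = (if m = 0 then std_normal_cdf x else if m = 1 then ?p x else if m = 2 then - x * ?p x
      else if m = 3 then (x\<^sup>2 - 1) * ?p x else (3 * x - x ^ 3) * ?p x)" for m x
  have dd: "(d m has_real_derivative d (Suc m) x) (at x)" if "m < 4" for m x
  proof -
    note [derivative_intros] = std_normal_cdf_deriv[THEN DERIV_chain2] std_normal_density_deriv[THEN DERIV_chain2]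
    have "m = 0 \<or> m = 1 \<or> m = 2 \<or> m = 3" using that by auto
    then show ?thesis unfolding d_def[abs_def]
      by (elim disjE) (auto intro!: derivative_eq_intros simp: power2_eq_square power3_eq_cube algebra_simps)
  qed
  define g where "g m z = d m (y + z) + (-1) ^ m * d m (y - z)" for m z
  have gd: "(g m has_real_derivative g (Suc m) z) (at z)" if "m < 4" for m z
    unfolding g_def[abs_def]
    by (auto intro!: derivative_eq_intros dd[OF that, THEN DERIV_chain2])
  obtain z where z: "0 < z" "z < h" "g 0 h = (\<Sum>m<4. g m 0 / fact m * h ^ m) + g 4 z / fact 4 * h ^ 4"
    using Maclaurin[of h 4 g "g 0"] gd h by auto
  have "(\<Sum>m<4. g m 0 / fact m * h ^ m) = 2 * std_normal_cdf y + h\<^sup>2 * (- y * ?p y)"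
    by (simp add: g_def d_def eval_nat_numeral lessThan_Suc)
  moreover have "g 4 z \<le> 24"
    using std_normal_fourth_deriv_bound[of "y + z"] std_normal_fourth_deriv_bound[of "y - z"]
    by (simp add: g_def d_def)
  then have "g 4 z / fact 4 * h ^ 4 \<le> 1 * h ^ 4"
    by (intro mult_right_mono) (auto simp: fact_numeral)
  moreover have "g 0 h = std_normal_cdf (y + h) + std_normal_cdf (y - h)" by (simp add: g_def d_def)
  ultimately show ?thesis using z(3) by simp
qed

lemma gaussian_supersolution_deriv:
  assumes "0 < a" "0 \<le> s"
  shows "((\<lambda>s. std_normal_cdf ((b - real_of_int x) / sqrt (s + a)) + (e + 1 / a - 1 / (s + a))) has_real_derivative
     - ((b - real_of_int x) / sqrt (s + a)) * std_normal_density ((b - real_of_int x) / sqrt (s + a)) / (2 * (s + a))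
     + 1 / (s + a)\<^sup>2) (at s)"
proof -
  have pos: "0 < s + a" using assms by simp
  have "((\<lambda>s. (b - real_of_int x) / sqrt (s + a)) has_real_derivative
      - ((b - real_of_int x) / sqrt (s + a)) / (2 * (s + a))) (at s)"
    using pos by (auto intro!: derivative_eq_intros simp: field_simps power2_eq_square)
  then have "((\<lambda>s. std_normal_cdf ((b - real_of_int x) / sqrt (s + a))) has_real_derivative
      std_normal_density ((b - real_of_int x) / sqrt (s + a)) * (- ((b - real_of_int x) / sqrt (s + a)) / (2 * (s + a)))) (at s)"
    by (rule DERIV_chain2[OF std_normal_cdf_deriv])
  moreover have "((\<lambda>s. e + 1 / a - 1 / (s + a)) has_real_derivative 1 / (s + a)\<^sup>2) (at s)"
    using pos by (auto intro!: derivative_eq_intros simp: field_simps power2_eq_square)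
  ultimately show ?thesis by (rule DERIV_cong[OF DERIV_add]) (simp add: mult_ac)
qed

text \<open>The Gaussian profile solves the continuous heat equation; its defect for the discrete one is
  at most 1/(s+a)^2, which the correction e + 1/a - 1/(s+a) absorbs.\<close>

lemma walk_neg_prob_le_normal:
  assumes e: "0 < e"
  shows "\<exists>a b. 0 < a \<and> 0 \<le> b \<and> (\<forall>t\<ge>0. \<forall>x::int. walk_neg_prob t x
      \<le> std_normal_cdf ((b - real_of_int x) / sqrt (t + a)) + 2 * e)"
proof -
  \<comment> \<open>The correction e + 1/a - 1/(s + a) then never exceeds 2e.\<close>
  define a where "a = 1 / e"
  have a: "0 < a" using e by (simp add: a_def)
  have "eventually (\<lambda>c. 1 - e < std_normal_cdf c) at_top"
    using std_normal_cdf_tendsto_1 by (rule order_tendstoD) (use e in simp)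
  then obtain c where c: "0 \<le> c" "1 - e < std_normal_cdf c"
    using eventually_conj[OF _ eventually_ge_at_top[of 0]] by (metis (mono_tags, lifting) eventually_at_top_linorder order_refl)
  \<comment> \<open>With this shift the profile at time 0 is above 1 - e on all negative sites, and
    the correction e lifts it above the indicator.\<close>
  define b where "b = c * sqrt a"
  define W where "W s x = std_normal_cdf ((b - real_of_int x) / sqrt (s + a)) + (e + 1 / a - 1 / (s + a))" for s and x :: int
  define W' where "W' s x = - ((b - real_of_int x) / sqrt (s + a)) * std_normal_density ((b - real_of_int x) / sqrt (s + a)) / (2 * (s + a))
     + 1 / (s + a)\<^sup>2" for s and x :: int
  have WW: "walk_neg_prob t x \<le> W t x" if t: "0 \<le> t" for t x
  proof -
    have "0 \<le> W t x - walk_neg_prob t x"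
    proof (rule heat_minimum_principle[where B=1 and D="\<lambda>s x. W s x - walk_neg_prob s x"
        and D'="\<lambda>s x. W' s x - (walk_neg_prob s (x + 1) + walk_neg_prob s (x - 1) - 2 * walk_neg_prob s x) / 2", OF _ _ _ _ _ t])
      fix s :: real and x :: int assume s: "0 \<le> s"
      show "((\<lambda>s. W s x - walk_neg_prob s x) has_real_derivative
         W' s x - (walk_neg_prob s (x + 1) + walk_neg_prob s (x - 1) - 2 * walk_neg_prob s x) / 2) (at s)"
        unfolding W_def W'_def
        by (intro DERIV_diff walk_neg_prob_deriv gaussian_supersolution_deriv a s)
      have pos: "0 < s + a" using s a by simp
      define y where "y = (b - real_of_int x) / sqrt (s + a)"
      \<comment> \<open>The lattice spacing in the rescaled variable y, so that h^4 has the same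
        order as the derivative of the correction.\<close>
      define h where "h = 1 / sqrt (s + a)"
      have h: "0 < h" "h\<^sup>2 = 1 / (s + a)" using pos by (auto simp: h_def power_divide)
      have h4: "h ^ 4 = 1 / (s + a)\<^sup>2"
      proof -
        have "h ^ 4 = (h\<^sup>2)\<^sup>2" by (simp flip: power_mult)
        then show ?thesis by (simp add: h(2) power_divide)
      qed
      have "(b - real_of_int (x + 1)) / sqrt (s + a) = y - h" "(b - real_of_int (x - 1)) / sqrt (s + a) = y + h"
        by (simp_all add: y_def h_def diff_divide_distrib add_divide_distrib)
      then have "(W s (x + 1) + W s (x - 1) - 2 * W s x) / 2
         = (std_normal_cdf (y + h) + std_normal_cdf (y - h) - 2 * std_normal_cdf y) / 2"
        by (simp add: W_def y_def)
      also have "\<dots> \<le> (h\<^sup>2 * (- y * std_normal_density y) + h ^ 4) / 2"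
        using std_normal_cdf_second_difference[OF h(1), of y] by simp
      also have "\<dots> \<le> W' s x"
      proof -
        have "1 / (s + a) * (- y * std_normal_density y) / 2 = - y * std_normal_density y / (2 * (s + a))"
          by simp
        moreover have "0 \<le> 1 / (s + a)\<^sup>2" by simp
        moreover have "p / 2 + z / 2 \<le> q + z" if "p / 2 = q" "0 \<le> z" for p q z :: real
          using that by simp
        ultimately show ?thesis
          unfolding W'_def y_def[symmetric] h4 h(2) add_divide_distrib by blast
      qed
      finally show "(W s (x + 1) - walk_neg_prob s (x + 1) + (W s (x - 1) - walk_neg_prob s (x - 1))
          - 2 * (W s x - walk_neg_prob s x)) / 2
        \<le> W' s x - (walk_neg_prob s (x + 1) + walk_neg_prob s (x - 1) - 2 * walk_neg_prob s x) / 2"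
        by (simp add: field_simps)
      have "1 / (s + a) \<le> 1 / a" using a s by (intro divide_left_mono) auto
      then have "0 \<le> W s x" unfolding W_def
        using e std_normal_cdf_pos[of "(b - real_of_int x) / sqrt (s + a)"] by linarith
      then show "- 1 \<le> W s x - walk_neg_prob s x" using walk_neg_prob_le_1[OF s, of x] by simp
    next
      fix x :: int
      have "1 \<le> W 0 x" if "x < 0"
      proof -
        have "b \<le> b - real_of_int x" using that by simp
        then have "c \<le> (b - real_of_int x) / sqrt a" using a by (simp add: b_def le_divide_eq)
        then have "std_normal_cdf c \<le> std_normal_cdf ((b - real_of_int x) / sqrt a)"
          by (rule std_normal_cdf_mono)
        then show ?thesis using c(2) by (simp add: W_def)
      qed
      moreover have "0 \<le> W 0 x"
        using e std_normal_cdf_pos[of "(b - real_of_int x) / sqrt a"] by (simp add: W_def)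
      ultimately show "0 \<le> W 0 x - walk_neg_prob 0 x" by (simp add: walk_neg_prob_0)
    qed simp
    then show ?thesis by simp
  qed
  have "W t x \<le> std_normal_cdf ((b - real_of_int x) / sqrt (t + a)) + 2 * e" if "0 \<le> t" for t x
    using that a by (simp add: W_def a_def)
  then have "\<forall>t\<ge>0. \<forall>x::int. walk_neg_prob t x
      \<le> std_normal_cdf ((b - real_of_int x) / sqrt (t + a)) + 2 * e"
    using WW order_trans by blast
  then show ?thesis using a c(1) by (intro exI[of _ a] exI[of _ b]) (auto simp: b_def)
qed

section \<open>The alternating dilogarithm\<close>

text \<open>In terms of the dilogarithm this is -Li_2(-y).\<close>

definition dilog_alt :: "real \<Rightarrow> real" where
  "dilog_alt y = (\<Sum>n. (- 1) ^ n * y ^ Suc n / (real (Suc n))\<^sup>2)"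

text \<open>The Basel sum minus twice its terms with even denominator, which make up a quarter of
  it: pi^2 / 6 - 2 (pi^2 / 24). Indices start at 0, so even denominators belong to odd n.\<close>

lemma alternating_inverse_squares: "(\<Sum>n. (- 1) ^ n / (real (Suc n))\<^sup>2) = pi\<^sup>2 / 12"
proof -
  define f where "f n = 1 / (real (Suc n))\<^sup>2" for n
  have f: "f sums (pi\<^sup>2 / 6)"
    using inverse_squares_sums by (simp add: f_def[abs_def] add.commute)
  have ev: "(\<lambda>n. f (2 * n + 1)) sums (pi\<^sup>2 / 6 / 4)"
  proof -
    have "f (2 * n + 1) = f n / 4" for n
      by (simp add: f_def power2_eq_square divide_simps) (simp add: algebra_simps)
    then have "(\<lambda>n. f (2 * n + 1)) = (\<lambda>n. f n / 4)" by (rule ext)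
    then show ?thesis using sums_divide[OF f, of 4] by (simp only:)
  qed
  define g where "g n = (if odd n then f n else 0)" for n
  have "g sums (pi\<^sup>2 / 6 / 4)"
  proof -
    have "(\<lambda>n. g (2 * n + 1)) sums (pi\<^sup>2 / 6 / 4)" using ev by (simp add: g_def)
    moreover have "strict_mono (\<lambda>n::nat. 2 * n + 1)" by (auto intro!: strict_monoI)
    moreover have "g n = 0" if "n \<notin> range (\<lambda>n::nat. 2 * n + 1)" for n
      using that by (auto simp: g_def elim!: oddE)
    ultimately show ?thesis using sums_mono_reindex[of "\<lambda>n::nat. 2 * n + 1" g] by simp
  qed
  from sums_diff[OF f sums_mult[OF this, of 2]]
  have "(\<lambda>n. f n - 2 * g n) sums (pi\<^sup>2 / 12)" by simp
  moreover have "f n - 2 * g n = (- 1) ^ n / (real (Suc n))\<^sup>2" for n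
    by (cases "even n") (auto simp: f_def g_def)
  ultimately show ?thesis by (simp add: sums_iff)
qed

lemma dilog_alt_deriv:
  assumes "0 < y" "y < 1"
  shows "(dilog_alt has_real_derivative ln (1 + y) / y) (at y)"
proof -
  define c :: "nat \<Rightarrow> real" where "c n = (if n = 0 then 0 else (- 1) ^ (n - 1) / (real n)\<^sup>2)" for n
  have cb: "\<bar>c n\<bar> \<le> 1" for n by (auto simp: c_def abs_mult power_abs divide_simps)
  have summ: "summable (\<lambda>n. c n * z ^ n)" if "\<bar>z\<bar> < 1" for z
  proof (rule summable_comparison_test)
    show "\<exists>N. \<forall>n\<ge>N. norm (c n * z ^ n) \<le> \<bar>z\<bar> ^ n"
      using cb by (auto simp: abs_mult power_abs intro!: mult_left_le_one_le)
    show "summable (\<lambda>n. \<bar>z\<bar> ^ n)" using that by (intro summable_geometric) auto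
  qed
  have "((\<lambda>z. \<Sum>n. c n * z ^ n) has_real_derivative (\<Sum>n. diffs c n * y ^ n)) (at y)"
    by (rule termdiffs_strong[OF summ[of "(1 + y) / 2"]]) (use assms in auto)
  moreover have "(\<Sum>n. diffs c n * y ^ n) = ln (1 + y) / y"
  proof -
    have "ln (1 + y) = (\<Sum>n. (- 1) ^ n * (1 / real (n + 1)) * (1 + y - 1) ^ Suc n)"
      using assms by (intro ln_series) auto
    also have "\<dots> = (\<Sum>n. y * (diffs c n * y ^ n))"
      by (intro suminf_cong) (simp add: diffs_def c_def power2_eq_square del: of_nat_Suc)
    also have "\<dots> = y * (\<Sum>n. diffs c n * y ^ n)"
      by (intro suminf_mult termdiff_converges[of _ 1]) (use assms summ in auto)
    finally show ?thesis using assms by simp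
  qed
  moreover have "(\<Sum>n. c n * z ^ n) = dilog_alt z" if "z \<in> {-1<..<1}" for z
  proof -
    have "\<bar>z\<bar> < 1" using that by auto
    then have "(\<Sum>n. c n * z ^ n) = (\<Sum>n. c (Suc n) * z ^ Suc n)"
      using suminf_split_head[OF summ[of z]] by (simp add: c_def[of 0])
    then show ?thesis by (simp add: dilog_alt_def c_def[of "Suc _"])
  qed
  ultimately show ?thesis
    using has_field_derivative_transform_within_open[of "\<lambda>z. \<Sum>n. c n * z ^ n" "ln (1 + y) / y" y "{-1<..<1}" dilog_alt]
      assms by auto
qed

text \<open>The derivative is available only inside (0, 1), while the value pi^2 / 12 sits at the
  endpoint 1; uniform convergence carries the comparison up to the boundary.\<close>

lemma dilog_alt_continuous: "continuous_on {0..1} dilog_alt"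
proof -
  have "uniform_limit {0..1} (\<lambda>n y. \<Sum>i<n. (- 1) ^ i * y ^ Suc i / (real (Suc i))\<^sup>2) dilog_alt sequentially"
    unfolding dilog_alt_def
  proof (rule Weierstrass_m_test)
    show "norm ((- 1) ^ n * y ^ Suc n / (real (Suc n))\<^sup>2) \<le> 1 / (real (Suc n))\<^sup>2" if "y \<in> {0..1}" for n and y :: real
      using that by (auto simp: abs_mult power_abs intro!: divide_right_mono power_le_one simp del: power_Suc of_nat_Suc)
    show "summable (\<lambda>n. 1 / (real (Suc n))\<^sup>2)"
      using inverse_squares_sums by (simp add: sums_iff add.commute)
  qed
  then show ?thesis
    by (rule uniform_limit_theorem[rotated]) (auto intro!: always_eventually continuous_intros simp del: power_Suc of_nat_Suc)
qed

lemma dilog_alt_1: "dilog_alt 1 = pi\<^sup>2 / 12"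
  using alternating_inverse_squares by (simp add: dilog_alt_def)

lemma dilog_alt_0: "dilog_alt 0 = 0" by (simp add: dilog_alt_def)

lemma dilog_alt_mono:
  assumes "0 \<le> x" "x \<le> y" "y \<le> 1"
  shows "dilog_alt x \<le> dilog_alt y"
proof (rule DERIV_nonneg_imp_increasing_open[OF assms(2)])
  fix z assume "x < z" "z < y"
  then show "\<exists>d. (dilog_alt has_real_derivative d) (at z) \<and> 0 \<le> d"
    using assms by (intro exI[of _ "ln (1 + z) / z"] conjI dilog_alt_deriv) auto
qed (use assms in \<open>auto intro: continuous_on_subset[OF dilog_alt_continuous]\<close>)

text \<open>Minus the alternating dilogarithm of exp(-x) is a primitive of ln (1 + exp(-x)).\<close>

lemma ln_exp_le_dilog_diff:
  assumes "0 < x" "0 < s"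
  shows "s * ln (1 + exp (- (x + s))) \<le> dilog_alt (exp (- x)) - dilog_alt (exp (- (x + s)))"
proof -
  have d: "((\<lambda>z. - dilog_alt (exp (- z))) has_real_derivative ln (1 + exp (- z))) (at z)" if "0 < z" for z
  proof -
    have "((\<lambda>z. - dilog_alt (exp (- z))) has_real_derivative - (ln (1 + exp (- z)) / exp (- z) * (exp (- z) * (- 1)))) (at z)"
      by (intro DERIV_minus DERIV_chain2[OF dilog_alt_deriv] DERIV_fun_exp derivative_intros) (use that in auto)
    then show ?thesis by simp
  qed
  obtain z where z: "x < z" "z < x + s"
    "- dilog_alt (exp (- (x + s))) - (- dilog_alt (exp (- x))) = (x + s - x) * ln (1 + exp (- z))"
    using MVT2[of x "x + s" "\<lambda>z. - dilog_alt (exp (- z))" "\<lambda>z. ln (1 + exp (- z))"] assms d by auto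
  have "s * ln (1 + exp (- (x + s))) \<le> s * ln (1 + exp (- z))"
    using assms z by (intro mult_left_mono) (auto simp: add_pos_pos)
  then show ?thesis using z(3) by simp
qed

text \<open>A Riemann sum with mesh s of a decreasing function: each term with k > 0 is paid for by
  the mesh cell to its left, and the primitives telescope. The term k = 0 has no full cell on the
  positive axis and costs ln 2.\<close>

lemma sum_ln_exp_le:
  assumes s: "0 < s"
  shows "(\<Sum>k\<le>n. ln (1 + exp (- (s * (real k + 1 / 2))))) \<le> ln 2 + pi\<^sup>2 / (12 * s)"
proof -
  define g where "g k = dilog_alt (exp (- (s * (real k + 1 / 2))))" for k
  have "s * (\<Sum>k\<in>{1..n}. ln (1 + exp (- (s * (real k + 1 / 2))))) \<le> pi\<^sup>2 / 12"
  proof -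
    have "s * (\<Sum>k=1..n. ln (1 + exp (- (s * (real k + 1 / 2))))) = (\<Sum>k<n. s * ln (1 + exp (- (s * (real k + 1 / 2) + s))))"
      unfolding sum_distrib_left
      by (rule sum.reindex_bij_witness[where i=Suc and j="\<lambda>k. k - 1"]) (auto simp: algebra_simps of_nat_diff)
    also have "\<dots> \<le> (\<Sum>k<n. g k - g (Suc k))"
    proof (rule sum_mono)
      fix k
      show "s * ln (1 + exp (- (s * (real k + 1 / 2) + s))) \<le> g k - g (Suc k)"
      proof -
        have "0 < s * (real k + 1 / 2)" using s by (intro mult_pos_pos) auto
        moreover have "s * (real k + 1 / 2) + s = s * (real (Suc k) + 1 / 2)" by (simp add: algebra_simps)
        ultimately show ?thesis
          using ln_exp_le_dilog_diff[of "s * (real k + 1 / 2)" s] s unfolding g_def by simp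
      qed
    qed
    also have "\<dots> = g 0 - g n" by (rule sum_lessThan_telescope')
    also have "\<dots> \<le> dilog_alt 1 - dilog_alt 0"
      unfolding g_def using s by (intro diff_mono dilog_alt_mono) auto
    finally show ?thesis by (simp add: dilog_alt_0 dilog_alt_1)
  qed
  then have "(\<Sum>k\<in>{1..n}. ln (1 + exp (- (s * (real k + 1 / 2))))) \<le> pi\<^sup>2 / (12 * s)"
    using s by (simp add: field_simps)
  moreover have "{..n} = insert 0 {1..n}" by auto
  moreover have "ln (1 + exp (- (s * (1 / 2)))) \<le> ln 2"
    using s by (subst ln_le_cancel_iff) (auto simp: add_pos_pos)
  ultimately show ?thesis by simp
qed

section \<open>Energy and the lower bound\<close>

text \<open>The energy is the number of boxes of the partition encoded by A when A is balanced; it is also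
  meaningful, and has the same drift, for unbalanced A, so that no charge needs to be tracked.\<close>

definition energy :: "nat \<Rightarrow> int set \<Rightarrow> real" where
  "energy N A = (\<Sum>x=- int N - 1..int N + 1. (real_of_int x + 1 / 2) * (of_bool (x \<in> A) - of_bool (x < 0)))"

text \<open>The shift by 1/2 makes every site weight nonzero with the sign of its only possible
  discrepancy from \<open>O_conf\<close>, so all contributions to the energy are
  nonnegative.\<close>

lemma energy_term: "(real_of_int x + 1 / 2) * (of_bool (x \<in> A) - of_bool (x < 0))
   = (if (x \<in> A) \<noteq> (x < 0) then \<bar>real_of_int x + 1 / 2\<bar> else 0)"
proof (cases "x < 0")
  case True
  then have "real_of_int x \<le> - 1" by simp
  then show ?thesis using True by simp
next
  case False
  then have "0 \<le> real_of_int x" by simp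
  then show ?thesis using False by simp
qed

lemma energy_nonneg: "0 \<le> energy N A"
  unfolding energy_def energy_term by (rule sum_nonneg) auto

lemma energy_O_conf: "energy N O_conf = 0"
  by (simp add: energy_def O_conf_def)

text \<open>A jump moves one particle by one site, so the energy changes by 1 in the direction of
  the jump. Writing the change as a difference of occupation numbers makes it telescope over
  edges.\<close>

lemma energy_flip:
  assumes "e \<in> {- int N - 1..int N}" "(e \<in> A) \<noteq> (e + 1 \<in> A)"
  shows "energy N (flip_edge e A) - energy N A = of_bool (e \<in> A) - of_bool (e + 1 \<in> A)"
proof -
  have "energy N (flip_edge e A) - energy N A
    = (\<Sum>x=- int N - 1..int N + 1. (real_of_int x + 1 / 2) * (of_bool (x \<in> flip_edge e A) - of_bool (x \<in> A)))"
    unfolding energy_def sum_subtractf[symmetric] by (rule sum.cong) (auto simp: algebra_simps)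
  also have "\<dots> = (\<Sum>x\<in>{e, e + 1}. (real_of_int x + 1 / 2) * (of_bool (x \<in> flip_edge e A) - of_bool (x \<in> A)))"
    using assms(1) by (intro sum.mono_neutral_right) (auto simp: flip_edge_mem)
  also have "\<dots> = of_bool (e \<in> A) - of_bool (e + 1 \<in> A)"
    using assms(2) by (auto simp: flip_edge_mem)
  finally show ?thesis .
qed

text \<open>The energy is summed over one site more on each side than the window. A flip out of the
  window creates a discrepancy at -N - 1 or N + 1, which alone contributes at least N + 1/2.\<close>

lemma energy_exit:
  assumes "A \<in> trunc_states N" "flip_edge e A \<notin> trunc_states N" "e \<in> {- int N - 1..int N}"
  shows "real N + 1 / 2 \<le> energy N (flip_edge e A)"
proof -
  obtain x where x: "(x < - int N \<and> x \<notin> flip_edge e A) \<or> (x > int N \<and> x \<in> flip_edge e A)"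
    using assms(2) unfolding trunc_states_iff by blast
  then have "x = e \<or> x = e + 1"
    using assms(1) unfolding trunc_states_iff flip_edge_mem by (auto split: if_splits)
  then have xw: "x \<in> {- int N - 1..int N + 1}" using assms(3) by auto
  have "real N + 1 / 2 \<le> (real_of_int x + 1 / 2) * (of_bool (x \<in> flip_edge e A) - of_bool (x < 0))"
  proof -
    from x consider "x = - int N - 1" "x \<notin> flip_edge e A" | "x = int N + 1" "x \<in> flip_edge e A"
      using xw by fastforce
    then show ?thesis by cases auto
  qed
  also have "\<dots> \<le> energy N (flip_edge e A)"
    unfolding energy_def using xw
    by (intro member_le_sum[where f="\<lambda>x. (real_of_int x + 1 / 2) * (of_bool (x \<in> flip_edge e A) - of_bool (x < 0))"])
       (auto simp: energy_term)
  finally show ?thesis .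
qed

lemma sum_int_telescope:
  fixes f :: "int \<Rightarrow> real"
  assumes "a \<le> b"
  shows "(\<Sum>e=a..b. f e - f (e + 1)) = f a - f (b + 1)"
proof -
  have "(\<Sum>e=a..b. f (e + 1)) = (\<Sum>e=a + 1..b + 1. f e)"
    by (rule sum.reindex_bij_witness[where i="\<lambda>e. e - 1" and j="\<lambda>e. e + 1"]) auto
  moreover have "{a..b} = insert a {a + 1..b}" "{a + 1..b + 1} = insert (b + 1) {a + 1..b}"
    using assms by auto
  ultimately show ?thesis by (simp add: sum_subtractf)
qed

text \<open>The drift is 1/2 in every state, because the edge contributions telescope to an occupied
  site on the far left and an empty one on the far right. On exit the energy is at least M, so
  replacing \<open>1 - energy / M\<close> by 0 can only raise the expectation.\<close>

lemma killed_energy_bound: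
  assumes t: "0 \<le> t" and M: "0 < M" "M \<le> real N + 1 / 2"
  shows "1 - t / (2 * M) \<le> (\<Sum>C\<in>trunc_states N. mexp (trunc_states N) (sep_gen (1/2)) t O_conf C * (1 - energy N C / M))"
proof -
  let ?T = "trunc_states N" and ?q = "sep_gen (1/2)"
  define F where "F s C = s / (2 * M) - (1 - energy N C / M)" for s C
  have "(\<Sum>C\<in>?T. mexp ?T ?q t O_conf C * F 0 C) \<le> F t O_conf"
  proof (rule mexp_supersolution[where F'="\<lambda>s C. 1 / (2 * M)", OF finite_trunc_states O_conf_trunc t])
    fix s A assume A: "A \<in> ?T" and s: "(0::real) \<le> s"
    show "((\<lambda>s. F s A) has_real_derivative 1 / (2 * M)) (at s)"
      unfolding F_def using M(1) by (auto intro!: derivative_eq_intros)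
    have "(\<Sum>D\<in>?T. ?q A D * F s D) \<le> (\<Sum>e=- int N - 1..int N. of_bool (e \<in> A) / (2 * M) - of_bool (e + 1 \<in> A) / (2 * M))"
      unfolding sep_gen_apply[OF A]
    proof (rule sum_mono)
      fix e assume e: "e \<in> {- int N - 1..int N}"
      show "(if (e \<in> A) \<noteq> (e + 1 \<in> A)
          then ((if flip_edge e A \<in> ?T then F s (flip_edge e A) else 0) - F s A) / 2 else 0)
        \<le> of_bool (e \<in> A) / (2 * M) - of_bool (e + 1 \<in> A) / (2 * M)"
      proof (cases "(e \<in> A) \<noteq> (e + 1 \<in> A)")
        case True
        have "(if flip_edge e A \<in> ?T then F s (flip_edge e A) else 0) \<le> F s (flip_edge e A)"
        proof (cases "flip_edge e A \<in> ?T")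
          case False
          then have "M \<le> energy N (flip_edge e A)" using energy_exit[OF A _ e] M by fastforce
          then have "1 \<le> energy N (flip_edge e A) / M" using M by simp
          moreover have "0 \<le> s / (2 * M)" using s M by simp
          ultimately show ?thesis using False by (simp add: F_def)
        qed simp
        moreover have "F s (flip_edge e A) - F s A = (energy N (flip_edge e A) - energy N A) / M"
          by (simp add: F_def diff_divide_distrib)
        moreover have "\<dots> / 2 = of_bool (e \<in> A) / (2 * M) - of_bool (e + 1 \<in> A) / (2 * M)"
          unfolding energy_flip[OF e True] by (simp add: diff_divide_distrib mult.commute)
        ultimately have "((if flip_edge e A \<in> ?T then F s (flip_edge e A) else 0) - F s A) / 2
            \<le> of_bool (e \<in> A) / (2 * M) - of_bool (e + 1 \<in> A) / (2 * M)" by simp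
        then show ?thesis unfolding if_P[OF True] .
      qed auto
    qed
    also have "\<dots> = of_bool (- int N - 1 \<in> A) / (2 * M) - of_bool (int N + 1 \<in> A) / (2 * M)"
      by (rule sum_int_telescope) simp
    also have "\<dots> = 1 / (2 * M)" using A by (simp add: trunc_states_iff)
    finally show "(\<Sum>D\<in>?T. ?q A D * F s D) \<le> 1 / (2 * M)" .
  qed (simp add: sep_gen_off)
  moreover have "(\<Sum>C\<in>?T. mexp ?T ?q t O_conf C * F 0 C) = - (\<Sum>C\<in>?T. mexp ?T ?q t O_conf C * (1 - energy N C / M))"
    unfolding F_def sum_negf[symmetric] by (rule sum.cong) (auto simp: algebra_simps)
  ultimately show ?thesis by (simp add: F_def energy_O_conf)
qed

lemma killed_trans_lower:
  assumes t: "0 \<le> t" and M: "0 < M" "M \<le> real N + 1 / 2" "t \<le> 4 * M"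
  shows "(1 - t / (4 * M))\<^sup>2 \<le> real (card {C\<in>trunc_states N. energy N C < M}) * killed_trans (1/2) N t O_conf O_conf"
proof -
  let ?T = "trunc_states N" and ?q = "sep_gen (1/2)"
  let ?S = "{C\<in>?T. energy N C < M}"
  define K where "K C = mexp ?T ?q (t / 2) O_conf C" for C
  have K0: "0 \<le> K C" if "C \<in> ?T" for C
    unfolding K_def using that t by (intro mexp_nonneg finite_trunc_states O_conf_trunc) (auto simp: sep_gen_off)
  have "1 - t / (4 * M) \<le> (\<Sum>C\<in>?T. K C * (1 - energy N C / M))"
    using killed_energy_bound[of "t / 2" M N] t M by (simp add: K_def)
  also have "\<dots> \<le> (\<Sum>C\<in>?T. if energy N C < M then K C else 0)"
  proof (rule sum_mono)
    fix C assume C: "C \<in> ?T"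
    \<comment> \<open>Markov's inequality in pointwise form: nonnegative energy puts the linear
      function below the indicator of low energy.\<close>
    have "1 - energy N C / M \<le> (if energy N C < M then 1 else 0)"
      using energy_nonneg[of N C] M by auto
    then have "K C * (1 - energy N C / M) \<le> K C * (if energy N C < M then 1 else 0)"
      using K0[OF C] by (rule mult_left_mono)
    then show "K C * (1 - energy N C / M) \<le> (if energy N C < M then K C else 0)" by (simp split: if_splits)
  qed
  also have "\<dots> = (\<Sum>C\<in>?S. K C)"
    using finite_trunc_states by (rule sum.inter_filter[symmetric])
  finally have "(1 - t / (4 * M))\<^sup>2 \<le> (\<Sum>C\<in>?S. K C)\<^sup>2"
    using M t by (intro power_mono) auto
  also have "\<dots> \<le> real (card ?S) * (\<Sum>C\<in>?S. (K C)\<^sup>2)"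
    using Cauchy_Schwarz_ineq_sum[of "\<lambda>_. 1" K ?S] by simp
  also have "\<dots> \<le> real (card ?S) * (\<Sum>C\<in>?T. (K C)\<^sup>2)"
    using finite_trunc_states by (intro mult_left_mono sum_mono2) auto
  also have "(\<Sum>C\<in>?T. (K C)\<^sup>2) = (\<Sum>C\<in>?T. mexp ?T ?q (t / 2) O_conf C * mexp ?T ?q (t / 2) C O_conf)"
  proof (rule sum.cong)
    fix C assume "C \<in> ?T"
    then show "(K C)\<^sup>2 = mexp ?T ?q (t / 2) O_conf C * mexp ?T ?q (t / 2) C O_conf"
      unfolding K_def power2_eq_square
      using mexp_sym[where t="t / 2", OF finite_trunc_states sep_gen_sym O_conf_trunc, of C N] by simp
  qed simp
  also have "\<dots> = mexp ?T ?q (t / 2 + t / 2) O_conf O_conf"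
    by (rule mexp_add[OF finite_trunc_states O_conf_trunc, symmetric])
  finally show ?thesis by (simp add: killed_trans_eq_mexp)
qed

section \<open>Counting configurations of low energy\<close>

lemma energy_eq_sum_discrepancy:
  assumes "D \<subseteq> {- int N..int N}"
  shows "energy N ((O_conf - D) \<union> (D - O_conf)) = (\<Sum>x\<in>D. \<bar>real_of_int x + 1 / 2\<bar>)"
proof -
  let ?C = "(O_conf - D) \<union> (D - O_conf)"
  have "x \<in> ?C \<longleftrightarrow> (x < 0) \<noteq> (x \<in> D)" for x by (auto simp: O_conf_def)
  then have eq: "(x \<in> ?C) \<noteq> (x < 0) \<longleftrightarrow> x \<in> D" for x by auto
  have "energy N ?C = (\<Sum>x=- int N - 1..int N + 1. if x \<in> D then \<bar>real_of_int x + 1 / 2\<bar> else 0)"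
    unfolding energy_def energy_term eq ..
  also have "\<dots> = (\<Sum>x\<in>{- int N - 1..int N + 1} \<inter> D. \<bar>real_of_int x + 1 / 2\<bar>)"
    by (rule sum.inter_restrict[symmetric]) simp
  also have "{- int N - 1..int N + 1} \<inter> D = D" using assms by auto
  finally show ?thesis .
qed

text \<open>The discrepancy from \<open>O_conf\<close> ranges over all subsets of the window without
  any balance constraint, and the energy is additive over it, so the sum factorizes over
  sites.\<close>

lemma partition_function:
  "(\<Sum>C\<in>trunc_states N. exp (- (r * energy N C))) = (\<Prod>x=- int N..int N. 1 + exp (- (r * \<bar>real_of_int x + 1 / 2\<bar>)))"
proof -
  let ?W = "{- int N..int N}" and ?d = "\<lambda>D. (O_conf - D) \<union> (D - O_conf)"
  let ?w = "\<lambda>x::int. exp (- (r * \<bar>real_of_int x + 1 / 2\<bar>))"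
  have "(\<Sum>C\<in>trunc_states N. exp (- (r * energy N C))) = (\<Sum>D\<in>Pow ?W. exp (- (r * energy N (?d D))))"
  proof (rule sum.reindex_bij_witness[where i="?d" and j="?d"])
    fix C assume "C \<in> trunc_states N"
    then show "?d C \<in> Pow ?W" by (auto simp: trunc_states_def)
  next
    fix D assume "D \<in> Pow ?W"
    moreover have "(?d D - O_conf) \<union> (O_conf - ?d D) = D" by auto
    ultimately show "?d D \<in> trunc_states N" unfolding trunc_states_def by auto
  next
    fix C :: "int set"
    have dd: "?d (?d C) = C" by auto
    then show "?d (?d C) = C" "exp (- (r * energy N (?d (?d C)))) = exp (- (r * energy N C))" by simp_all
  qed (auto)
  also have "\<dots> = (\<Sum>D\<in>Pow ?W. (\<Prod>x\<in>D. ?w x) * (\<Prod>x\<in>?W - D. 1))"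
  proof (rule sum.cong)
    fix D assume "D \<in> Pow ?W"
    then show "exp (- (r * energy N (?d D))) = (\<Prod>x\<in>D. ?w x) * (\<Prod>x\<in>?W - D. 1)"
      using energy_eq_sum_discrepancy[of D N] finite_subset[of D ?W]
      by (simp add: exp_sum[symmetric] sum_distrib_left sum_negf)
  qed simp
  also have "\<dots> = (\<Prod>x\<in>?W. ?w x + 1)" by (rule prod_add[symmetric]) simp
  finally show ?thesis by (simp add: add.commute)
qed

text \<open>The sites k and -k - 1 have equal weight, so two half-line products appear. Each
  contributes a factor 2 and half of the exponent.\<close>

lemma partition_function_bound:
  assumes r: "0 < r"
  shows "(\<Prod>x=- int N..int N. 1 + exp (- (r * \<bar>real_of_int x + 1 / 2\<bar>))) \<le> 4 * exp (pi\<^sup>2 / (6 * r))"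
proof -
  let ?w = "\<lambda>x::int. 1 + exp (- (r * \<bar>real_of_int x + 1 / 2\<bar>))"
  let ?g = "\<lambda>k::nat. 1 + exp (- (r * (real k + 1 / 2)))"
  have g1: "1 \<le> ?g k" for k by simp
  have g: "(\<Prod>k\<le>n. ?g k) \<le> 2 * exp (pi\<^sup>2 / (12 * r))" for n
  proof -
    have "(\<Prod>k\<le>n. ?g k) = exp (\<Sum>k\<le>n. ln (?g k))"
      by (subst exp_sum) (auto simp: add_pos_pos intro!: prod.cong)
    also have "\<dots> \<le> exp (ln 2 + pi\<^sup>2 / (12 * r))" using sum_ln_exp_le[OF r, of n] by simp
    finally show ?thesis by (simp add: exp_add)
  qed
  have "(\<Prod>x=0..int N. ?w x) = (\<Prod>k\<le>N. ?g k)"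
    by (rule prod.reindex_bij_witness[where i=int and j=nat]) auto
  moreover have "(\<Prod>x=- int N..-1. ?w x) = (\<Prod>k<N. ?g k)"
    by (rule prod.reindex_bij_witness[where i="\<lambda>k. - int k - 1" and j="\<lambda>x. nat (- x - 1)"]) auto
  moreover have "(\<Prod>k<N. ?g k) \<le> (\<Prod>k\<le>N. ?g k)"
    by (rule prod_mono2) (auto simp: add_nonneg_nonneg)
  moreover have "{- int N..int N} = {- int N..-1} \<union> {0..int N}" "{- int N..-1} \<inter> {0..int N} = {}" by auto
  then have "(\<Prod>x=- int N..int N. ?w x) = (\<Prod>x=- int N..-1. ?w x) * (\<Prod>x=0..int N. ?w x)"
    by (simp add: prod.union_disjoint)
  ultimately have "(\<Prod>x=- int N..int N. ?w x) \<le> (2 * exp (pi\<^sup>2 / (12 * r))) * (2 * exp (pi\<^sup>2 / (12 * r)))"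
    using g[of N] by (simp only:) (intro mult_mono, auto intro!: prod_nonneg simp: add_nonneg_nonneg)
  also have "\<dots> = 4 * exp (pi\<^sup>2 / (12 * r) + pi\<^sup>2 / (12 * r))" by (simp only: exp_add)
  also have "pi\<^sup>2 / (12 * r) + pi\<^sup>2 / (12 * r) = pi\<^sup>2 / (6 * r)" by (simp add: field_simps)
  finally show ?thesis .
qed

lemma card_low_energy:
  assumes M: "0 < M"
  shows "real (card {C\<in>trunc_states N. energy N C < M}) \<le> 4 * exp (2 * pi * sqrt (M / 6))"
proof -
  \<comment> \<open>The minimizer of r M + pi^2 / (6 r); at this point both terms equal pi sqrt (M /
    6).\<close>
  define r where "r = pi / sqrt (6 * M)"
  have r: "0 < r" using M by (simp add: r_def)
  let ?S = "{C\<in>trunc_states N. energy N C < M}"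
  have "real (card ?S) = (\<Sum>C\<in>?S. 1)" by simp
  also have "\<dots> \<le> (\<Sum>C\<in>?S. exp (r * M) * exp (- (r * energy N C)))"
    using r by (intro sum_mono) (auto simp: exp_add[symmetric])
  also have "\<dots> \<le> (\<Sum>C\<in>trunc_states N. exp (r * M) * exp (- (r * energy N C)))"
    using finite_trunc_states by (intro sum_mono2) auto
  also have "\<dots> = exp (r * M) * (\<Prod>x=- int N..int N. 1 + exp (- (r * \<bar>real_of_int x + 1 / 2\<bar>)))"
    unfolding sum_distrib_left[symmetric] partition_function ..
  also have "\<dots> \<le> exp (r * M) * (4 * exp (pi\<^sup>2 / (6 * r)))"
    using partition_function_bound[OF r] by (intro mult_left_mono) auto
  also have "\<dots> = 4 * exp (r * M + pi\<^sup>2 / (6 * r))" by (simp add: exp_add)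
  also have "r * M + pi\<^sup>2 / (6 * r) = 2 * pi * sqrt (M / 6)"
  proof -
    have "sqrt M * sqrt M = M" "sqrt 6 * sqrt 6 = (6::real)" using M by simp_all
    then have 1: "r * M = pi * sqrt (M / 6)"
      using M by (simp add: r_def real_sqrt_divide real_sqrt_mult divide_simps)
    have "pi\<^sup>2 / (6 * r) = pi * sqrt (6 * M) / 6"
      using M by (simp add: r_def power2_eq_square)
    also have "\<dots> = pi * sqrt (M / 6)"
      using \<open>sqrt 6 * sqrt 6 = 6\<close> by (simp add: real_sqrt_divide real_sqrt_mult divide_simps)
    finally show ?thesis using 1 by simp
  qed
  finally show ?thesis .
qed

lemma prob_return_lower:
  assumes t: "0 \<le> t" and M: "0 < M" "t \<le> 4 * M"
  shows "(1 - t / (4 * M))\<^sup>2 / (4 * exp (2 * pi * sqrt (M / 6))) \<le> prob_return (1/2) t"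
proof (rule LIMSEQ_le_const[OF killed_trans_tendsto[OF t]])
  obtain n0 :: nat where n0: "M \<le> real n0" using real_arch_simple by blast
  show "\<exists>N. \<forall>n\<ge>N. (1 - t / (4 * M))\<^sup>2 / (4 * exp (2 * pi * sqrt (M / 6))) \<le> killed_trans (1/2) n t O_conf O_conf"
  proof (intro exI[of _ n0] allI impI)
    fix n assume "n0 \<le> n"
    then have "M \<le> real n + 1 / 2" using n0 by linarith
    then have "(1 - t / (4 * M))\<^sup>2 \<le> real (card {C\<in>trunc_states n. energy n C < M}) * killed_trans (1/2) n t O_conf O_conf"
      using killed_trans_lower t M by blast
    also have "\<dots> \<le> (4 * exp (2 * pi * sqrt (M / 6))) * killed_trans (1/2) n t O_conf O_conf"
      unfolding killed_trans_eq_mexp using t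
      by (intro mult_right_mono card_low_energy M mexp_nonneg finite_trunc_states O_conf_trunc) (auto simp: sep_gen_off)
    finally show "(1 - t / (4 * M))\<^sup>2 / (4 * exp (2 * pi * sqrt (M / 6))) \<le> killed_trans (1/2) n t O_conf O_conf"
      by (simp add: divide_le_eq mult.commute)
  qed
qed

section \<open>Asymptotics\<close>

lemma prob_return_le_normal:
  assumes "0 < e"
  shows "\<exists>a b. 0 < a \<and> 0 \<le> b \<and> (\<forall>t\<ge>0. \<forall>m. prob_return (1/2) t
      \<le> (\<Prod>k<m. std_normal_cdf ((b + 1 + real k) / sqrt (t + a)) + 2 * e))"
proof -
  obtain a b where ab: "0 < a" "0 \<le> b"
    and le: "\<And>t x. 0 \<le> t \<Longrightarrow> walk_neg_prob t x \<le> std_normal_cdf ((b - real_of_int x) / sqrt (t + a)) + 2 * e"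
    using walk_neg_prob_le_normal[OF assms] by blast
  have "prob_return (1/2) t \<le> (\<Prod>k<m. std_normal_cdf ((b + 1 + real k) / sqrt (t + a)) + 2 * e)"
    if t: "0 \<le> t" for t m
  proof -
    have "prob_return (1/2) t \<le> (\<Prod>x=- int m..-1. walk_neg_prob t x)"
      by (rule prob_return_upper[where u=walk_neg_prob, OF t walk_neg_prob_deriv order_refl
            walk_neg_prob_nonneg walk_neg_prob_dec _ walk_neg_prob_le_1]) (simp_all add: walk_neg_prob_0)
    also have "\<dots> \<le> (\<Prod>x=- int m..-1. std_normal_cdf ((b - real_of_int x) / sqrt (t + a)) + 2 * e)"
      using walk_neg_prob_nonneg le t by (intro prod_mono) auto
    also have "\<dots> = (\<Prod>k<m. std_normal_cdf ((b + 1 + real k) / sqrt (t + a)) + 2 * e)"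
      by (rule prod.reindex_bij_witness[where i="\<lambda>k. - int k - 1" and j="\<lambda>x. nat (- x - 1)"])
         (auto simp: add.commute add.left_commute)
    finally show ?thesis .
  qed
  then show ?thesis using ab by blast
qed

lemma prob_return_pos:
  assumes "0 \<le> t"
  shows "0 < prob_return (1/2) t"
proof -
  \<comment> \<open>The choice M = t + 1 keeps 4 M strictly above t, so the lower bound is strictly
    positive.\<close>
  have "0 < 1 - t / (4 * (t + 1))" using assms by (simp add: field_simps)
  then have "0 < (1 - t / (4 * (t + 1)))\<^sup>2 / (4 * exp (2 * pi * sqrt ((t + 1) / 6)))" by (intro divide_pos_pos zero_less_power) auto
  also have "\<dots> \<le> prob_return (1/2) t" using assms by (intro prob_return_lower) auto
  finally show ?thesis .
qed

lemma std_normal_cdf_continuous: "continuous_on S std_normal_cdf"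
  by (intro continuous_at_imp_continuous_on ballI DERIV_isCont[OF std_normal_cdf_deriv])

lemma ln_cdf_continuous: "0 \<le> e \<Longrightarrow> continuous_on S (\<lambda>x. ln (std_normal_cdf x + e))"
  using std_normal_cdf_pos by (intro continuous_intros std_normal_cdf_continuous) (auto simp: add_pos_nonneg less_imp_neq[symmetric])

text \<open>The integrand increases, so its value at the left end of a cell of length 1 / T is at
  most the cell average; the cells then telescope through \<open>J\<close>.\<close>

lemma riemann_sum_ln_cdf:
  fixes b T :: real
  assumes e: "0 \<le> e" and b: "0 \<le> b" and T: "0 < T"
  defines "J \<equiv> \<lambda>y. integral {0..y} (\<lambda>x. ln (std_normal_cdf x + e))"
  shows "(\<Sum>k<m. ln (std_normal_cdf ((b + real k) / T) + e)) \<le> T * (J ((b + real m) / T) - J (b / T))"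
proof -
  let ?G = "\<lambda>x. ln (std_normal_cdf x + e)"
  have int: "?G integrable_on {x..y}" for x y
    by (intro integrable_continuous_real ln_cdf_continuous e)
  have step: "?G ((b + real k) / T) \<le> T * (J ((b + real (Suc k)) / T) - J ((b + real k) / T))" for k
  proof -
    define x where "x = (b + real k) / T"
    have x: "0 \<le> x" "x \<le> x + 1 / T" using b T by (auto simp: x_def)
    have "J x + integral {x..x + 1 / T} ?G = J (x + 1 / T)"
      unfolding J_def by (rule Henstock_Kurzweil_Integration.integral_combine) (use x int in auto)
    moreover have "integral {x..x + 1 / T} (\<lambda>_. ?G x) \<le> integral {x..x + 1 / T} ?G"
      using std_normal_cdf_mono std_normal_cdf_pos[of x] e
      by (intro integral_le int) (auto intro!: ln_mono add_pos_nonneg)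
    moreover have "integral {x..x + 1 / T} (\<lambda>_. ?G x) = ?G x / T" using T by simp
    ultimately have "?G x / T \<le> J (x + 1 / T) - J x" by linarith
    then have "?G x \<le> T * (J (x + 1 / T) - J x)" using T by (simp add: divide_le_eq mult.commute)
    moreover have "x + 1 / T = (b + real (Suc k)) / T" by (simp add: x_def add_divide_distrib)
    ultimately show ?thesis by (simp add: x_def)
  qed
  have "(\<Sum>k<m. ?G ((b + real k) / T)) \<le> (\<Sum>k<m. T * (J ((b + real (Suc k)) / T) - J ((b + real k) / T)))"
    by (intro sum_mono step)
  also have "\<dots> = T * (J ((b + real m) / T) - J (b / T))"
    using sum_lessThan_telescope[of "\<lambda>k. J ((b + real k) / T)" m] by (simp flip: sum_distrib_left)
  finally show ?thesis .
qed

lemma eventually_ln_prob_return_less_regularized: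
  assumes e: "0 < e" and X: "0 \<le> X"
    and c: "integral {0..X} (\<lambda>x. ln (std_normal_cdf x + 2 * e)) < c"
  shows "eventually (\<lambda>t. ln (prob_return (1/2) t) / sqrt t < c) at_top"
proof -
  obtain a b where a: "0 < a" and b: "0 \<le> b"
    and le: "\<And>t m. 0 \<le> t \<Longrightarrow> prob_return (1/2) t \<le> (\<Prod>k<m. std_normal_cdf ((b + 1 + real k) / sqrt (t + a)) + 2 * e)"
    using prob_return_le_normal[OF e] by blast
  define J where "J y = integral {0..y} (\<lambda>x. ln (std_normal_cdf x + 2 * e))" for y
  \<comment> \<open>As many factors as reach the point X on the diffusive scale; beyond it the
    additive error \<open>2 * e\<close> could push factors above 1.\<close>
  define m where "m t = nat \<lfloor>X * sqrt (t + a)\<rfloor>" for t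
  define R where "R t = sqrt (t + a) / sqrt t * (J ((b + 1 + real (m t)) / sqrt (t + a)) - J ((b + 1) / sqrt (t + a)))" for t
  \<comment> \<open>The upper limit of integration may exceed X because of the shift b + 1;
    eventually it stays below X + 1.\<close>
  have contJ: "continuous_on {0..X + 1} J"
    unfolding J_def using e by (intro indefinite_integral_continuous_1 integrable_continuous_real ln_cdf_continuous) auto
  have T: "filterlim (\<lambda>t. sqrt (t + a)) at_top at_top"
    by (rule filterlim_compose[OF sqrt_at_top]) (use filterlim_tendsto_add_at_top[OF tendsto_const filterlim_ident, of a] in \<open>simp add: add.commute\<close>)
  have inv: "((\<lambda>t. k / sqrt (t + a)) \<longlongrightarrow> 0) at_top" for k
    by (rule real_tendsto_divide_at_top[OF tendsto_const T])
  have ratio: "((\<lambda>t. sqrt (t + a) / sqrt t) \<longlongrightarrow> 1) at_top"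
  proof -
    have "((\<lambda>t. sqrt (1 + a / t)) \<longlongrightarrow> sqrt (1 + 0)) at_top"
      by (intro tendsto_intros real_tendsto_divide_at_top[OF tendsto_const filterlim_ident])
    moreover have "eventually (\<lambda>t. sqrt (1 + a / t) = sqrt (t + a) / sqrt t) at_top"
      using eventually_gt_at_top[of 0]
      by eventually_elim (simp add: field_simps flip: real_sqrt_divide)
    ultimately show ?thesis by (simp add: filterlim_cong)
  qed
  have m: "((\<lambda>t. (b + 1 + real (m t)) / sqrt (t + a)) \<longlongrightarrow> X) at_top"
  proof (rule tendsto_sandwich)
    show "((\<lambda>t. X + b / sqrt (t + a)) \<longlongrightarrow> X) at_top" "((\<lambda>t. X + (b + 1) / sqrt (t + a)) \<longlongrightarrow> X) at_top"
      using tendsto_add[OF tendsto_const inv] by auto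
    have fl: "X * sqrt (t + a) - 1 \<le> real (m t)" "real (m t) \<le> X * sqrt (t + a)" if "0 < t" for t
    proof -
      have "0 \<le> X * sqrt (t + a)" using X a that by simp
      then have "real (m t) = of_int \<lfloor>X * sqrt (t + a)\<rfloor>" by (simp add: m_def)
      then show "X * sqrt (t + a) - 1 \<le> real (m t)" "real (m t) \<le> X * sqrt (t + a)" by linarith+
    qed
    show "eventually (\<lambda>t. X + b / sqrt (t + a) \<le> (b + 1 + real (m t)) / sqrt (t + a)) at_top"
      using eventually_gt_at_top[of 0]
    proof eventually_elim
      case (elim t)
      then have "0 < sqrt (t + a)" using a by simp
      then have "X + b / sqrt (t + a) = (X * sqrt (t + a) + b) / sqrt (t + a)"
        by (simp only: add_divide_distrib) simp
      then show ?case using fl(1)[OF elim] \<open>0 < sqrt (t + a)\<close> by (simp add: divide_right_mono)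
    qed
    show "eventually (\<lambda>t. (b + 1 + real (m t)) / sqrt (t + a) \<le> X + (b + 1) / sqrt (t + a)) at_top"
      using eventually_gt_at_top[of 0]
    proof eventually_elim
      case (elim t)
      then have "0 < sqrt (t + a)" using a by simp
      then have "X + (b + 1) / sqrt (t + a) = (X * sqrt (t + a) + (b + 1)) / sqrt (t + a)"
        by (simp only: add_divide_distrib) simp
      then show ?case using fl(2)[OF elim] \<open>0 < sqrt (t + a)\<close> by (simp add: divide_right_mono)
    qed
  qed
  have "(R \<longlongrightarrow> 1 * (J X - J 0)) at_top"
    unfolding R_def
  proof (intro tendsto_mult ratio tendsto_diff)
    have "eventually (\<lambda>t. (b + 1 + real (m t)) / sqrt (t + a) < X + 1) at_top"
      by (rule order_tendstoD(2)[OF m]) simp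
    moreover have "eventually (\<lambda>t. 0 \<le> (b + 1 + real (m t)) / sqrt (t + a)) at_top"
      using eventually_gt_at_top[of 0] by eventually_elim (use a b in auto)
    ultimately have "eventually (\<lambda>t. (b + 1 + real (m t)) / sqrt (t + a) \<in> {0..X + 1}) at_top"
      by eventually_elim auto
    then show "((\<lambda>t. J ((b + 1 + real (m t)) / sqrt (t + a))) \<longlongrightarrow> J X) at_top"
      using X by (intro continuous_on_tendsto_compose[OF contJ m]) auto
    have "eventually (\<lambda>t. (b + 1) / sqrt (t + a) < X + 1) at_top"
      by (rule order_tendstoD(2)[OF inv]) (use X in simp)
    moreover have "eventually (\<lambda>t. 0 \<le> (b + 1) / sqrt (t + a)) at_top"
      using eventually_gt_at_top[of 0] by eventually_elim (use a b in auto)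
    ultimately have "eventually (\<lambda>t. (b + 1) / sqrt (t + a) \<in> {0..X + 1}) at_top"
      by eventually_elim auto
    then show "((\<lambda>t. J ((b + 1) / sqrt (t + a))) \<longlongrightarrow> J 0) at_top"
      using X by (intro continuous_on_tendsto_compose[OF contJ inv]) auto
  qed
  then have "eventually (\<lambda>t. R t < c) at_top"
    by (rule order_tendstoD(2)) (use c in \<open>simp add: J_def\<close>)
  then show ?thesis
    using eventually_gt_at_top[of 0]
  proof eventually_elim
    case (elim t)
    have st: "0 < sqrt (t + a)" "0 < sqrt t" using elim a by auto
    have pos: "0 < std_normal_cdf x + 2 * e" for x using std_normal_cdf_pos[of x] e by simp
    have "ln (prob_return (1/2) t) \<le> ln (\<Prod>k<m t. std_normal_cdf ((b + 1 + real k) / sqrt (t + a)) + 2 * e)"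
      using le[of t "m t"] prob_return_pos[of t] elim by (intro ln_mono) auto
    also have "\<dots> = (\<Sum>k<m t. ln (std_normal_cdf ((b + 1 + real k) / sqrt (t + a)) + 2 * e))"
      using less_imp_neq[OF pos, symmetric] by (intro ln_prod) (auto simp: pos)
    also have "\<dots> \<le> sqrt (t + a) * (J ((b + 1 + real (m t)) / sqrt (t + a)) - J ((b + 1) / sqrt (t + a)))"
      unfolding J_def using e b st by (intro riemann_sum_ln_cdf) auto
    finally have "ln (prob_return (1/2) t) / sqrt t \<le> R t"
      using st by (simp add: R_def divide_right_mono)
    then show ?case using elim by simp
  qed
qed

lemma eventually_ln_prob_return_less:
  assumes X: "0 \<le> X" and c: "integral {0..X} (\<lambda>x. ln (std_normal_cdf x)) < c"
  shows "eventually (\<lambda>t. ln (prob_return (1/2) t) / sqrt t < c) at_top"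
proof -
  define L where "L = integral {0..X} (\<lambda>x. ln (std_normal_cdf x))"
  define p where "p = std_normal_cdf 0"
  have p: "0 < p" by (simp add: p_def std_normal_cdf_pos)
  \<comment> \<open>On [0, X] the regularization raises the logarithm by at most 2e / p, since the
    distribution function is at least p there. The total X * 2e / p is then less than half of c - L,
    and X + 1 also covers X = 0.\<close>
  define e where "e = (c - L) * p / (4 * (X + 1))"
  have e: "0 < e" using c p X by (simp add: e_def L_def)
  have "integral {0..X} (\<lambda>x. ln (std_normal_cdf x + 2 * e)) \<le> integral {0..X} (\<lambda>x. ln (std_normal_cdf x) + 2 * e / p)"
  proof (rule integral_le)
    show "(\<lambda>x. ln (std_normal_cdf x + 2 * e)) integrable_on {0..X}"
      using e by (intro integrable_continuous_real ln_cdf_continuous) auto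
    show "(\<lambda>x. ln (std_normal_cdf x) + 2 * e / p) integrable_on {0..X}"
      using ln_cdf_continuous[of 0] by (intro integrable_continuous_real continuous_on_add continuous_on_const) simp
    fix x assume x: "x \<in> {0..X}"
    let ?q = "std_normal_cdf x"
    have q: "0 < ?q" "p \<le> ?q" using x std_normal_cdf_pos std_normal_cdf_mono by (auto simp: p_def)
    have "?q + 2 * e = ?q * (1 + 2 * e / ?q)" using q by (simp add: field_simps)
    moreover have "0 < 1 + 2 * e / ?q" using q e by (intro add_pos_pos) auto
    ultimately have "ln (?q + 2 * e) = ln ?q + ln (1 + 2 * e / ?q)"
      using q by (simp only: ln_mult_pos)
    also have "ln (1 + 2 * e / ?q) \<le> 2 * e / ?q" using q e by (intro ln_add_one_self_le_self) auto
    also have "2 * e / ?q \<le> 2 * e / p" using q e p by (intro divide_left_mono) auto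
    finally show "ln (?q + 2 * e) \<le> ln ?q + 2 * e / p" by simp
  qed
  also have "\<dots> = L + X * (2 * e / p)"
    unfolding L_def using ln_cdf_continuous[of 0 "{0..X}"] X
    by (subst integral_add) (auto intro!: integrable_continuous_real continuous_intros)
  also have "\<dots> < c"
  proof -
    have "X * (2 * e / p) = (c - L) * (X / (2 * (X + 1)))"
      using p X by (simp add: e_def divide_simps) (simp add: algebra_simps)
    also have "\<dots> < (c - L) * 1" using c X by (intro mult_strict_left_mono) (auto simp: L_def divide_less_eq)
    finally show ?thesis by simp
  qed
  finally show ?thesis by (rule eventually_ln_prob_return_less_regularized[OF e X])
qed

lemma Limsup_ln_prob_return_le:
  assumes "0 \<le> X"
  shows "Limsup at_top (\<lambda>t. ereal (ln (prob_return (1/2) t) / sqrt t)) \<le> ereal (integral {0..X} (\<lambda>x. ln (std_normal_cdf x)))"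
  unfolding Limsup_le_iff
proof (intro allI impI)
  fix y assume y: "ereal (integral {0..X} (\<lambda>x. ln (std_normal_cdf x))) < y"
  show "eventually (\<lambda>t. ereal (ln (prob_return (1/2) t) / sqrt t) < y) at_top"
    using y eventually_ln_prob_return_less[OF assms] by (cases y) auto
qed

text \<open>Supplies the constant \<open>c'\<close>: the cutoff at 1 already gives a strictly
  negative upper bound.\<close>

lemma integral_ln_cdf_neg: "integral {0..1} (\<lambda>x. ln (std_normal_cdf x)) < 0"
proof -
  have "integral {0..1} (\<lambda>x. ln (std_normal_cdf x)) \<le> integral {0..1::real} (\<lambda>x. ln (std_normal_cdf 1))"
    using ln_cdf_continuous[of 0 "{0..1}"] std_normal_cdf_mono std_normal_cdf_pos
    by (intro integral_le integrable_continuous_real) (auto intro!: ln_mono)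
  also have "\<dots> = ln (std_normal_cdf 1)" by simp
  also have "\<dots> < 0" using std_normal_cdf_pos[of 1] std_normal_cdf_less_1[of 1] by simp
  finally show ?thesis .
qed

lemma Limsup_ln_prob_return_le_LINT:
  "Limsup at_top (\<lambda>t. ereal (ln (prob_return (1/2) t) / sqrt t))
     \<le> - ereal (LINT x:{0..}|lborel. - ln (std_normal_cdf x))" (is "?L \<le> _")
proof (cases "set_integrable lborel {0..} (\<lambda>x. - ln (std_normal_cdf x))")
  case True
  let ?g = "\<lambda>X. LINT x:{0..X}|lborel. - ln (std_normal_cdf x)"
  have lim: "(?g \<longlongrightarrow> (LINT x:{0..}|lborel. - ln (std_normal_cdf x))) at_top"
    using True by (intro tendsto_set_lebesgue_integral_at_top) auto
  have eq: "?g X = - integral {0..X} (\<lambda>x. ln (std_normal_cdf x))" for X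
  proof -
    have "set_integrable lborel {0..X} (\<lambda>x. - ln (std_normal_cdf x))"
      using ln_cdf_continuous[of 0 "{0..X}"] by (intro borel_integrable_atLeastAtMost' continuous_on_minus) simp
    then show ?thesis using set_borel_integral_eq_integral(2) by fastforce
  qed
  show ?thesis
  proof (rule tendsto_lowerbound)
    show "((\<lambda>X. ereal (- ?g X)) \<longlongrightarrow> - ereal (LINT x:{0..}|lborel. - ln (std_normal_cdf x))) at_top"
      using tendsto_minus[OF lim] by simp
    show "eventually (\<lambda>X. ?L \<le> ereal (- ?g X)) at_top"
      using eventually_ge_at_top[of 0] by eventually_elim (simp only: eq minus_minus Limsup_ln_prob_return_le)
  qed simp
next
  case False
  \<comment> \<open>The Lebesgue integral of a nonintegrable function is 0 by convention, so the
    claim reduces to the bound with the empty cutoff X = 0. The case split takes the place of a tail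
    estimate.\<close>
  then have "(LINT x:{0..}|lborel. - ln (std_normal_cdf x)) = 0"
    unfolding set_integrable_def set_lebesgue_integral_def by (rule not_integrable_integral_eq)
  then show ?thesis using Limsup_ln_prob_return_le[of 0] by simp
qed

lemma eventually_ln_prob_return_greater:
  assumes c: "c < - (pi / sqrt 6)"
  shows "eventually (\<lambda>t. c < ln (prob_return (1/2) t) / sqrt t) at_top"
proof -
  define v where "v = pi / sqrt 6"
  \<comment> \<open>The midpoint between 1 and -c / v, so that k > 1 and still c < - k v.\<close>
  define k where "k = (- c / v + 1) / 2"
  have v: "0 < v" by (simp add: v_def)
  have "1 < - c / v" using c unfolding v_def[symmetric] pos_less_divide_eq[OF v] by simp
  then have k1: "1 < k" by (simp add: k_def)
  have "k * v = (- c + v) / 2" using v by (simp add: k_def field_simps)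
  moreover have "c < - v" using c by (simp add: v_def)
  ultimately have k2: "c < - (k * v)" by argo
  note k = k1 k2
  \<comment> \<open>The prefactor of the lower bound. It does not depend on t, so its logarithm
    vanishes after division by sqrt t.\<close>
  define d where "d = (1 - 1 / k\<^sup>2)\<^sup>2 / 4"
  have "1 < k\<^sup>2" using k by simp
  then have d: "0 < d" by (simp add: d_def)
  have "((\<lambda>t. ln d / sqrt t - k * v) \<longlongrightarrow> 0 - k * v) at_top"
    by (intro tendsto_intros real_tendsto_divide_at_top[OF tendsto_const sqrt_at_top])
  then have "eventually (\<lambda>t. c < ln d / sqrt t - k * v) at_top"
    by (rule order_tendstoD) (use k in simp)
  then show ?thesis using eventually_gt_at_top[of 0]
  proof eventually_elim
    case (elim t)
    \<comment> \<open>Proportional to t, so that t / (4 M) is the constant 1 / k^2 and the entropy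
      exponent becomes k v sqrt t.\<close>
    define M where "M = k\<^sup>2 * t / 4"
    have M: "0 < M" "t \<le> 4 * M" using elim k1 \<open>1 < k\<^sup>2\<close> by (auto simp: M_def)
    have "t / (4 * M) = 1 / k\<^sup>2" using elim by (simp add: M_def)
    moreover have "2 * pi * sqrt (M / 6) = k * v * sqrt t"
    proof -
      have "M / 6 = (k / 2)\<^sup>2 * (t / 6)" by (simp add: M_def power_divide)
      then have "sqrt (M / 6) = k / 2 * (sqrt t / sqrt 6)"
        using k by (simp add: real_sqrt_mult real_sqrt_divide)
      then show ?thesis by (simp add: v_def)
    qed
    ultimately have "d / exp (k * v * sqrt t) \<le> prob_return (1/2) t"
      using prob_return_lower[OF _ M] elim by (simp add: d_def)
    then have "ln (d / exp (k * v * sqrt t)) \<le> ln (prob_return (1/2) t)"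
      using d by (intro ln_mono) auto
    then have "ln d - k * v * sqrt t \<le> ln (prob_return (1/2) t)" using d by (simp add: ln_div)
    then have "(ln d - k * v * sqrt t) / sqrt t \<le> ln (prob_return (1/2) t) / sqrt t"
      using elim by (intro divide_right_mono) auto
    then show ?case using elim by (simp add: diff_divide_distrib)
  qed
qed

lemma Liminf_ln_prob_return_ge:
  "- ereal (pi / sqrt 6) \<le> Liminf at_top (\<lambda>t. ereal (ln (prob_return (1/2) t) / sqrt t))"
  unfolding le_Liminf_iff
proof (intro allI impI)
  fix y assume y: "y < - ereal (pi / sqrt 6)"
  show "eventually (\<lambda>t. y < ereal (ln (prob_return (1/2) t) / sqrt t)) at_top"
    using y eventually_ln_prob_return_greater by (cases y) auto
qed

theorem theorem3p4:
  fixes p :: real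
  assumes "p = 1 / 2"
  shows "- ereal (pi / sqrt 6) \<le> Liminf at_top (\<lambda>t::real. ereal (ln (prob_return p t) / sqrt t))
    \<and> Liminf at_top (\<lambda>t::real. ereal (ln (prob_return p t) / sqrt t))
        \<le> Limsup at_top (\<lambda>t::real. ereal (ln (prob_return p t) / sqrt t))
    \<and> Limsup at_top (\<lambda>t::real. ereal (ln (prob_return p t) / sqrt t))
        \<le> - ereal (LINT x:{0..}|lborel. - ln (std_normal_cdf x))
    \<and> (\<exists>c c'. c > 0 \<and> c' > 0
        \<and> - ereal c \<le> Liminf at_top (\<lambda>t::real. ereal (ln (prob_return p t) / sqrt t))
        \<and> Limsup at_top (\<lambda>t::real. ereal (ln (prob_return p t) / sqrt t)) \<le> - ereal c')"
  unfolding assms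
proof (intro conjI)
  let ?c' = "- integral {0..1} (\<lambda>x. ln (std_normal_cdf x))"
  have "?c' > 0" using integral_ln_cdf_neg by simp
  moreover have "Limsup at_top (\<lambda>t. ereal (ln (prob_return (1/2) t) / sqrt t)) \<le> - ereal ?c'"
    using Limsup_ln_prob_return_le[of 1] by simp
  ultimately show "\<exists>c c'. c > 0 \<and> c' > 0
        \<and> - ereal c \<le> Liminf at_top (\<lambda>t::real. ereal (ln (prob_return (1/2) t) / sqrt t))
        \<and> Limsup at_top (\<lambda>t::real. ereal (ln (prob_return (1/2) t) / sqrt t)) \<le> - ereal c'"
    using Liminf_ln_prob_return_ge by (intro exI[of _ "pi / sqrt 6"] exI[of _ ?c']) auto
qed (rule Liminf_ln_prob_return_ge Limsup_ln_prob_return_le_LINT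
    Liminf_le_Limsup[OF trivial_limit_at_top_linorder])+

end
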